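(* Let $P(\lambda)=\sum_{i=0}^d A_i\lambda^i$ be a regular $n\times n$ complex matrix polynomial of degree $d$. Assume $d$ is divisible by $\ell\ge1$, and let $\mathcal{L}(\lambda)$ be an $(\epsilon,n,\eta,n)$-block Kronecker companion form (companion $\ell$-ification) of $P(\lambda)$. If $\lambda_0$ is a simple, finite, nonzero eigenvalue of $P(\lambda)$, then $$\frac{\mathrm{coeff\,cond}_{\mathcal{L}}(\lambda_0)}{\mathrm{coeff\,cond}_{P}(\lambda_0)}\le 16d^3(\epsilon+1)^{3/2}(\eta+1)^{3/2}\,\frac{\max\{1,\max_{0\le i\le d}\|A_i\|_2^3\}}{\min\{\|A_0\|_2,\|A_d\|_2\}}$$ (the right-hand side being read as $+\infty$ if $A_0=0$), and $$\frac{\mathrm{coeff\,cond}_{\mathcal{L}}(\lambda_0)}{\mathrm{norm\,cond}_{P}(\lambda_0)}\le 16d^3(\epsilon+1)^{3/2}(\eta+1)^{3/2}\,\frac{\max\{1,\max_{0\le i\le d}\|A_i\|_2^3\}}{\max_{0\le i\le d}\|A_i\|_2}.$$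
   Context: A matrix polynomial $P(\lambda)=\sum_{i=0}^d A_i\lambda^i$, $A_i\in\mathbb{C}^{n\times n}$, is regular if $\det P(\lambda)\not\equiv 0$; it has degree $d$ if $A_d\ne0$. Right/left eigenvectors of $P$ for an eigenvalue $\lambda_0$ are nonzero $x,y$ with $P(\lambda_0)x=0$, $y^*P(\lambda_0)=0$. Condition numbers: for a simple, finite, nonzero eigenvalue $\lambda_0$ of $P(\lambda)=\sum_{i=0}^d A_i\lambda^i$ with right and left eigenvectors $x,y$, $$\mathrm{coeff\,cond}_P(\lambda_0)=\frac{\left(\sum_{i=0}^d|\lambda_0|^i\|A_i\|_2\right)\|x\|_2\|y\|_2}{|\lambda_0|\,|y^*P'(\lambda_0)x|},\qquad \mathrm{norm\,cond}_P(\lambda_0)=\frac{\|[A_0\ \cdots\ A_d]\|_2\left(\sum_{i=0}^d|\lambda_0|^i\right)\|x\|_2\|y\|_2}{|\lambda_0|\,|y^*P'(\lambda_0)x|}.$$ For $\mathcal{L}(\lambda)=\sum_{i=0}^\ell\mathcal{L}_i\lambda^i$, $\mathrm{coeff\,cond}_{\mathcal{L}}(\lambda_0)$ is given by the same formula with $\mathcal{L}_i$, $\ell$ and the right/left eigenvectors of $\mathcal{L}$. ($\lambda_0$ is also a simple eigenvalue of $\mathcal{L}$.) For $k\ge0$, $L_k(\lambda)$ is the $k\times(k+1)$ matrix with entries $-1$ at positions $(i,i)$, $\lambda$ at positions $(i,i+1)$, and $0$ elsewhere ($L_0$ is the empty $0\times1$ matrix, and the corresponding block row/column below is absent), and $\Lambda_k(\lambda)=[\lambda^k\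 \lambda^{k-1}\ \cdots\ \lambda\ 1]^T$. $\otimes$ is the Kronecker product. Block Kronecker companion form: let $\ell$ divide $d$ and let $\epsilon,\eta\ge0$ be integers with $\epsilon+\eta+1=d/\ell$. An $(\epsilon,n,\eta,n)$-block Kronecker $\ell$-ification of $P$ is a matrix polynomial $$\mathcal{L}(\lambda)=\begin{bmatrix} M(\lambda) & L_\eta(\lambda^\ell)^T\otimes I_n\\ L_\epsilon(\lambda^\ell)\otimes I_n & 0\end{bmatrix},\qquad M(\lambda)=\sum_{t=0}^\ell M_t\lambda^t\in\mathbb{C}[\lambda]^{(\eta+1)n\times(\epsilon+1)n},$$ with $(\Lambda_\eta(\lambda^\ell)^T\otimes I_n)M(\lambda)(\Lambda_\epsilon(\lambda^\ell)\otimes I_n)=P(\lambda)$. It is a block Kronecker companion form (companion $\ell$-ification) of $P$ if moreover, viewing each $M_t$ as an $(\eta+1)\times(\epsilon+1)$ block matrix with $n\times n$ blocks, every block of every $M_t$ is either $0$, $I_n$, or $A_i$ for some $i\in\{0,\dots,d\}$. *)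

theory Defs
  imports
    "Jordan_Normal_Form.Matrix"
    "Jordan_Normal_Form.Determinant"
    "Jordan_Normal_Form.Conjugate"
    "HOL-Analysis.L2_Norm"
    "HOL-Library.Extended_Real"
begin

section \<open>Matrix polynomials\<close>

text \<open>A matrix polynomial is a matrix whose entries are polynomials.\<close>

definition mat_poly_coeff :: "'a::zero poly mat \<Rightarrow> nat \<Rightarrow> 'a mat" where
  "mat_poly_coeff P i = map_mat (\<lambda>p. coeff p i) P"

definition mat_poly_eval :: "'a::comm_semiring_0 poly mat \<Rightarrow> 'a \<Rightarrow> 'a mat" where
  "mat_poly_eval P z = map_mat (\<lambda>p. poly p z) P"

definition mat_poly_deriv :: "complex poly mat \<Rightarrow> complex poly mat" where
  "mat_poly_deriv P = map_mat pderiv P"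

definition mat_poly_has_grade :: "'a::zero poly mat \<Rightarrow> nat \<Rightarrow> bool" where
  "mat_poly_has_grade P d \<longleftrightarrow>
     (\<forall>i>d. mat_poly_coeff P i = 0\<^sub>m (dim_row P) (dim_col P))"

definition mat_poly_has_degree :: "'a::zero poly mat \<Rightarrow> nat \<Rightarrow> bool" where
  "mat_poly_has_degree P d \<longleftrightarrow>
     mat_poly_has_grade P d \<and> mat_poly_coeff P d \<noteq> 0\<^sub>m (dim_row P) (dim_col P)"

definition regular_mat_poly :: "complex poly mat \<Rightarrow> bool" where
  "regular_mat_poly P \<longleftrightarrow> square_mat P \<and> Determinant.det P \<noteq> 0"

text \<open>A finite eigenvalue is simple if its algebraic multiplicity, i.e. its multiplicity
  as a root of the determinant, is one.\<close>

definition simple_eigenvalue :: "complex poly mat \<Rightarrow> complex \<Rightarrow> bool" where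
  "simple_eigenvalue P z \<longleftrightarrow> regular_mat_poly P \<and> order z (Determinant.det P) = 1"

definition right_eigenvector :: "complex poly mat \<Rightarrow> complex \<Rightarrow> complex Matrix.vec \<Rightarrow> bool" where
  "right_eigenvector P z x \<longleftrightarrow>
     x \<in> carrier_vec (dim_col P) \<and> x \<noteq> 0\<^sub>v (dim_col P) \<and>
     mat_poly_eval P z *\<^sub>v x = 0\<^sub>v (dim_row P)"

definition left_eigenvector :: "complex poly mat \<Rightarrow> complex \<Rightarrow> complex Matrix.vec \<Rightarrow> bool" where
  "left_eigenvector P z y \<longleftrightarrow>
     y \<in> carrier_vec (dim_row P) \<and> y \<noteq> 0\<^sub>v (dim_row P) \<and>
     mat_of_row (conjugate y) * mat_poly_eval P z = 0\<^sub>m 1 (dim_col P)"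

section \<open>Norms and condition numbers\<close>

definition vec_norm2 :: "complex Matrix.vec \<Rightarrow> real" where
  "vec_norm2 v = L2_set (\<lambda>i. cmod (vec_index v i)) {..<dim_vec v}"

text \<open>The operator norm, in the format of \<open>onorm\<close>: the zero vector contributes
  the harmless quotient 0 / 0 = 0.\<close>

definition spectral_norm :: "complex mat \<Rightarrow> real" where
  "spectral_norm X =
     (SUP v \<in> carrier_vec (dim_col X). vec_norm2 (X *\<^sub>v v) / vec_norm2 v)"

text \<open>The block row $[A_0\ \cdots\ A_d]$ of coefficients.\<close>

definition coeff_block_row :: "nat \<Rightarrow> complex poly mat \<Rightarrow> complex mat" where
  "coeff_block_row d P =
     mat (dim_row P) ((d + 1) * dim_col P)
       (\<lambda>(i, j). mat_poly_coeff P (j div dim_col P) $$ (i, j mod dim_col P))"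

text \<open>The condition numbers of an eigenvalue are written as functions of the chosen right and
  left eigenvectors \<open>x\<close> and \<open>y\<close>; for a simple eigenvalue these are unique up to nonzero
  scalar factors, on which the values do not depend, and the denominators do not vanish.
  The argument \<open>d\<close> is the index of the last coefficient.\<close>

definition coeff_cond ::
  "nat \<Rightarrow> complex poly mat \<Rightarrow> complex \<Rightarrow> complex Matrix.vec \<Rightarrow> complex Matrix.vec \<Rightarrow> real" where
  "coeff_cond d P z x y =
     (\<Sum>i=0..d. cmod z ^ i * spectral_norm (mat_poly_coeff P i)) * vec_norm2 x * vec_norm2 y /
     (cmod z * cmod (scalar_prod (conjugate y) (mat_poly_eval (mat_poly_deriv P) z *\<^sub>v x)))"

definition norm_cond ::
  "nat \<Rightarrow> complex poly mat \<Rightarrow> complex \<Rightarrow> complex Matrix.vec \<Rightarrow> complex Matrix.vec \<Rightarrow> real" where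
  "norm_cond d P z x y =
     spectral_norm (coeff_block_row d P) * (\<Sum>i=0..d. cmod z ^ i) * vec_norm2 x * vec_norm2 y /
     (cmod z * cmod (scalar_prod (conjugate y) (mat_poly_eval (mat_poly_deriv P) z *\<^sub>v x)))"

section \<open>Block Kronecker companion forms\<close>

definition kronecker :: "'a::times mat \<Rightarrow> 'a mat \<Rightarrow> 'a mat" where
  "kronecker A B =
     mat (dim_row A * dim_row B) (dim_col A * dim_col B)
       (\<lambda>(i, j). A $$ (i div dim_row B, j div dim_col B) * B $$ (i mod dim_row B, j mod dim_col B))"

text \<open>\<open>L_mat k q\<close> and \<open>Lambda_mat k q\<close> are $L_k$ and $\Lambda_k$ with the polynomial \<open>q\<close>
  substituted for the variable; \<open>q = monom 1 l\<close> gives $L_k(\lambda^l)$ and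
  $\Lambda_k(\lambda^l)$.\<close>

definition L_mat :: "nat \<Rightarrow> complex poly \<Rightarrow> complex poly mat" where
  "L_mat k q = mat k (k + 1) (\<lambda>(i, j). if j = i then - 1 else if j = i + 1 then q else 0)"

definition Lambda_mat :: "nat \<Rightarrow> complex poly \<Rightarrow> complex poly mat" where
  "Lambda_mat k q = mat (k + 1) 1 (\<lambda>(i, _). q ^ (k - i))"

text \<open>\<open>LL\<close> is an $(\epsilon,n,\eta,n)$-block Kronecker \<open>l\<close>-ification of \<open>P\<close>
  with (1,1) block \<open>M\<close>.\<close>

definition block_kronecker_lification ::
  "nat \<Rightarrow> nat \<Rightarrow> nat \<Rightarrow> nat \<Rightarrow> complex poly mat \<Rightarrow> complex poly mat \<Rightarrow> complex poly mat \<Rightarrow> bool" where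
  "block_kronecker_lification \<epsilon> n \<eta> l P M LL \<longleftrightarrow>
     M \<in> carrier_mat ((\<eta> + 1) * n) ((\<epsilon> + 1) * n) \<and>
     mat_poly_has_grade M l \<and>
     kronecker (transpose_mat (Lambda_mat \<eta> (monom 1 l))) (1\<^sub>m n) * M *
       kronecker (Lambda_mat \<epsilon> (monom 1 l)) (1\<^sub>m n) = P \<and>
     LL = four_block_mat
            M (kronecker (transpose_mat (L_mat \<eta> (monom 1 l))) (1\<^sub>m n))
            (kronecker (L_mat \<epsilon> (monom 1 l)) (1\<^sub>m n)) (0\<^sub>m (\<epsilon> * n) (\<eta> * n))"

text \<open>Block \<open>(p, q)\<close>, counted from 0, of a matrix partitioned into \<open>n \<times> n\<close> blocks.\<close>

definition mat_block :: "nat \<Rightarrow> 'a mat \<Rightarrow> nat \<Rightarrow> nat \<Rightarrow> 'a mat" where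
  "mat_block n X p q = mat n n (\<lambda>(i, j). X $$ (p * n + i, q * n + j))"

definition block_kronecker_companion_form ::
  "nat \<Rightarrow> nat \<Rightarrow> nat \<Rightarrow> nat \<Rightarrow> nat \<Rightarrow> complex poly mat \<Rightarrow> complex poly mat \<Rightarrow> bool" where
  "block_kronecker_companion_form \<epsilon> n \<eta> l d P LL \<longleftrightarrow>
     (\<exists>M. block_kronecker_lification \<epsilon> n \<eta> l P M LL \<and>
          (\<forall>t\<le>l. \<forall>p\<le>\<eta>. \<forall>q\<le>\<epsilon>.
             mat_block n (mat_poly_coeff M t) p q \<in>
               {0\<^sub>m n n, 1\<^sub>m n} \<union> mat_poly_coeff P ` {0..d}))"

end

theory Submission
  imports Defs
begin

text \<open>
  A right null vector of \<open>LL\<close> at \<open>z\<close> has the form $v = (\Lambda_\epsilon(s) \otimes x', u)$ with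
  $s = z^l$ and $P(z) x' = 0$, and a left one is similarly built from a left null vector \<open>y'\<close> of
  \<open>P\<close>. Keeping \<open>u\<close> constant and letting \<open>s\<close> vary, the bilinear form of \<open>LL\<close> on two such
  vectors is that of \<open>P\<close> on \<open>y'\<close> and \<open>x'\<close>; differentiating at \<open>z\<close> shows that both
  condition numbers have the same denominator, since simplicity of \<open>z\<close> makes \<open>x'\<close> and
  \<open>y'\<close> multiples of \<open>x\<close> and \<open>y\<close>. The blocks of \<open>u\<close> satisfy a first-order recursion
  with factor \<open>s\<close>, solved from the top when $|s| \le 1$ and from the bottom when $|s| > 1$.
  With $m = \max(1, \max_i \|A_i\|)$ and $\rho = \max(1, |z|)$ this gives
  $\|v\| \le (\eta+1)^{3/2} (\epsilon+1) (l+1) m \rho^{l\epsilon} \|x'\|$, and symmetrically for the left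
  vector. Every block of a coefficient of \<open>LL\<close> has norm at most \<open>m\<close>, so these
  coefficients have norm at most $m (\epsilon+\eta+1)$. The powers of $\rho$ multiply up to $\rho^d$, which
  the coefficient sums of \<open>P\<close> compensate, and
  $(\epsilon+1)(\eta+1) \le (\epsilon+\eta+1)^2$ collects the remaining factors into $d^3$.
\<close>

section \<open>Norms\<close>

lemma vec_norm2_nonneg [simp]: "0 \<le> vec_norm2 v"
  by (simp add: vec_norm2_def L2_set_nonneg)

lemma vec_norm2_square: "(vec_norm2 v)\<^sup>2 = (\<Sum>i<dim_vec v. (cmod (v $ i))\<^sup>2)"
  by (simp add: vec_norm2_def L2_set_def sum_nonneg)

lemma vec_norm2_triangle:
  assumes "u \<in> carrier_vec n" "v \<in> carrier_vec n"
  shows "vec_norm2 (u + v) \<le> vec_norm2 u + vec_norm2 v"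
proof -
  have "vec_norm2 (u + v) = L2_set (\<lambda>i. cmod (u $ i + v $ i)) {..<n}"
    unfolding vec_norm2_def using assms by (intro L2_set_cong) auto
  also have "\<dots> \<le> L2_set (\<lambda>i. cmod (u $ i) + cmod (v $ i)) {..<n}"
    by (intro L2_set_mono norm_triangle_ineq) auto
  also have "\<dots> \<le> L2_set (\<lambda>i. cmod (u $ i)) {..<n} + L2_set (\<lambda>i. cmod (v $ i)) {..<n}"
    by (rule L2_set_triangle_ineq)
  finally show ?thesis using assms by (simp add: vec_norm2_def)
qed

lemma vec_norm2_smult [simp]: "vec_norm2 (c \<cdot>\<^sub>v v) = cmod c * vec_norm2 v"
  unfolding vec_norm2_def L2_set_right_distrib[OF norm_ge_zero]
  by (intro L2_set_cong) (auto simp: norm_mult)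

lemma vec_norm2_zero [simp]: "vec_norm2 (0\<^sub>v n) = 0"
  by (simp add: vec_norm2_def L2_set_eq_0_iff)

lemma vec_norm2_eq_0_iff: "v \<in> carrier_vec n \<Longrightarrow> vec_norm2 v = 0 \<longleftrightarrow> v = 0\<^sub>v n"
  by (auto simp: vec_norm2_def L2_set_eq_0_iff)

lemma vec_norm2_conjugate [simp]: "vec_norm2 (conjugate v) = vec_norm2 v"
  unfolding vec_norm2_def by (intro L2_set_cong) auto

lemma vec_norm2_le_sum: "vec_norm2 v \<le> (\<Sum>i<dim_vec v. cmod (v $ i))"
  unfolding vec_norm2_def by (rule L2_set_le_sum) simp

lemma cmod_index_le_vec_norm2: "i < dim_vec v \<Longrightarrow> cmod (v $ i) \<le> vec_norm2 v"
  unfolding vec_norm2_def by (rule member_le_L2_set) auto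

text \<open>The dimension is not part of the type of a vector, so there is no single zero vector to
  sum from. Sums of vectors are therefore written entrywise, here and in
  \<open>vec_block_mult\<close>.\<close>

lemma vec_norm2_sum:
  assumes "finite A" "\<And>q. q \<in> A \<Longrightarrow> f q \<in> carrier_vec n"
  shows "vec_norm2 (vec n (\<lambda>i. \<Sum>q\<in>A. f q $ i)) \<le> (\<Sum>q\<in>A. vec_norm2 (f q))"
  using assms
proof (induction A rule: finite_induct)
  case empty
  have "vec n (\<lambda>i. \<Sum>q\<in>{}. f q $ i) = 0\<^sub>v n" by auto
  then show ?case by (metis order_refl sum.empty vec_norm2_zero)
next
  case (insert a A)
  have "vec n (\<lambda>i. \<Sum>q\<in>insert a A. f q $ i) = f a + vec n (\<lambda>i. \<Sum>q\<in>A. f q $ i)"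
    using insert by (intro eq_vecI) auto
  then have "vec_norm2 (vec n (\<lambda>i. \<Sum>q\<in>insert a A. f q $ i))
      \<le> vec_norm2 (f a) + vec_norm2 (vec n (\<lambda>i. \<Sum>q\<in>A. f q $ i))"
    using vec_norm2_triangle[of "f a" n "vec n (\<lambda>i. \<Sum>q\<in>A. f q $ i)"] insert.prems
    by simp
  with insert show ?case by simp
qed

lemma cmod_scalar_prod_le:
  assumes "u \<in> carrier_vec n" "v \<in> carrier_vec n"
  shows "cmod (u \<bullet> v) \<le> vec_norm2 u * vec_norm2 v"
proof -
  have "cmod (u \<bullet> v) \<le> (\<Sum>i<n. \<bar>cmod (u $ i)\<bar> * \<bar>cmod (v $ i)\<bar>)"
    unfolding scalar_prod_def using assms
    by (auto intro!: order_trans[OF norm_sum] sum_mono simp: norm_mult lessThan_atLeast0)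
  also have "\<dots> \<le> vec_norm2 u * vec_norm2 v"
    using L2_set_mult_ineq[of "\<lambda>i. cmod (u $ i)" "\<lambda>i. cmod (v $ i)" "{..<n}"] assms
    by (simp add: vec_norm2_def)
  finally show ?thesis .
qed

lemma scalar_prod_conjugate_self: "conjugate v \<bullet> v = complex_of_real ((vec_norm2 v)\<^sup>2)"
  unfolding vec_norm2_square scalar_prod_def
  by (auto intro!: sum.cong simp: lessThan_atLeast0 complex_norm_square mult.commute simp del: of_real_power)

section \<open>The spectral norm as an operator norm\<close>

lemma mult_mat_vec_entry:
  "X \<in> carrier_mat nr nc \<Longrightarrow> v \<in> carrier_vec nc \<Longrightarrow> i < nr \<Longrightarrow>
    (X *\<^sub>v v) $ i = (\<Sum>j<nc. X $$ (i, j) * v $ j)"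
  by (auto simp: scalar_prod_def lessThan_atLeast0)

text \<open>A crude bound by the sum of all entries suffices: its purpose is to make the supremum in
  \<open>spectral_norm\<close> one over a bounded set.\<close>

lemma mult_mat_vec_bounded:
  assumes X: "X \<in> carrier_mat nr nc"
  shows "\<exists>B. \<forall>v\<in>carrier_vec nc. vec_norm2 (X *\<^sub>v v) \<le> B * vec_norm2 v"
proof (intro exI ballI)
  fix v :: "complex Matrix.vec" assume v: "v \<in> carrier_vec nc"
  have "vec_norm2 (X *\<^sub>v v) \<le> (\<Sum>i<nr. cmod ((X *\<^sub>v v) $ i))"
    using vec_norm2_le_sum[of "X *\<^sub>v v"] X by simp
  also have "\<dots> \<le> (\<Sum>i<nr. \<Sum>j<nc. cmod (X $$ (i, j)) * vec_norm2 v)"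
    using X v cmod_index_le_vec_norm2[of _ v]
    by (auto intro!: sum_mono order_trans[OF norm_sum] mult_left_mono
        simp: mult_mat_vec_entry[OF X v] norm_mult simp del: index_mult_mat_vec)
  finally show "vec_norm2 (X *\<^sub>v v) \<le> (\<Sum>i<nr. \<Sum>j<nc. cmod (X $$ (i, j))) * vec_norm2 v"
    by (simp add: sum_distrib_right)
qed

lemma bdd_above_norm_quotients:
  "bdd_above ((\<lambda>v. vec_norm2 (X *\<^sub>v v) / vec_norm2 v) ` carrier_vec (dim_col X))"
proof -
  obtain B where B: "\<forall>v\<in>carrier_vec (dim_col X). vec_norm2 (X *\<^sub>v v) \<le> B * vec_norm2 v"
    using mult_mat_vec_bounded[of X "dim_row X" "dim_col X"] by auto
  \<comment> \<open>The maximum with 0 covers vectors of norm 0, whose quotient is 0 while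
    \<open>B\<close> may be negative.\<close>
  have "vec_norm2 (X *\<^sub>v u) / vec_norm2 u \<le> max 0 B" if "u \<in> carrier_vec (dim_col X)" for u
    using bspec[OF B that] vec_norm2_nonneg[of u]
    by (cases "vec_norm2 u = 0") (auto simp: divide_simps le_max_iff_disj)
  then show ?thesis by (rule bdd_aboveI2)
qed

lemma vec_norm2_mult_le:
  assumes X: "X \<in> carrier_mat nr nc" and v: "v \<in> carrier_vec nc"
  shows "vec_norm2 (X *\<^sub>v v) \<le> spectral_norm X * vec_norm2 v"
proof (cases "vec_norm2 v = 0")
  case True
  with v have "v = 0\<^sub>v nc" by (simp add: vec_norm2_eq_0_iff)
  with X have "X *\<^sub>v v = 0\<^sub>v nr" by (intro eq_vecI) (auto simp: scalar_prod_def)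
  then show ?thesis using True by simp
next
  case False
  have "vec_norm2 (X *\<^sub>v v) / vec_norm2 v \<le> spectral_norm X"
    unfolding spectral_norm_def using bdd_above_norm_quotients v X by (intro cSUP_upper) auto
  moreover have "vec_norm2 v > 0" using False vec_norm2_nonneg[of v] by linarith
  ultimately show ?thesis by (simp add: divide_simps)
qed

lemma spectral_norm_nonneg [simp]: "0 \<le> spectral_norm X"
proof -
  have "vec_norm2 (X *\<^sub>v 0\<^sub>v (dim_col X)) / vec_norm2 (0\<^sub>v (dim_col X)) \<le> spectral_norm X"
    unfolding spectral_norm_def using bdd_above_norm_quotients by (intro cSUP_upper) auto
  then show ?thesis by simp
qed

lemma spectral_norm_le:
  assumes "X \<in> carrier_mat nr nc" "0 \<le> c"
    and "\<And>v. v \<in> carrier_vec nc \<Longrightarrow> vec_norm2 (X *\<^sub>v v) \<le> c * vec_norm2 v"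
  shows "spectral_norm X \<le> c"
  unfolding spectral_norm_def
proof (rule cSUP_least)
  fix v :: "complex Matrix.vec" assume v: "v \<in> carrier_vec (dim_col X)"
  then have "vec_norm2 (X *\<^sub>v v) \<le> c * vec_norm2 v" using assms by auto
  then show "vec_norm2 (X *\<^sub>v v) / vec_norm2 v \<le> c"
    using assms(2) vec_norm2_nonneg[of v]
    by (cases "vec_norm2 v = 0") (auto simp: divide_simps less_le)
qed (auto intro: zero_carrier_vec)

text \<open>A matrix of norm 0 kills every unit vector, so all its columns vanish. This keeps the
  denominators of the final bounds positive.\<close>

lemma spectral_norm_pos:
  assumes X: "X \<in> carrier_mat nr nc" and "X \<noteq> 0\<^sub>m nr nc"
  shows "0 < spectral_norm X"
proof (rule ccontr)
  assume "\<not> 0 < spectral_norm X"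
  then have 0: "spectral_norm X = 0" using spectral_norm_nonneg[of X] by linarith
  have "X $$ (i, j) = 0" if ij: "i < nr" "j < nc" for i j
  proof -
    have "vec_norm2 (X *\<^sub>v unit_vec nc j) = 0"
      using vec_norm2_mult_le[OF X, of "unit_vec nc j"] 0 vec_norm2_nonneg[of "X *\<^sub>v unit_vec nc j"]
      by simp
    then have "X *\<^sub>v unit_vec nc j = 0\<^sub>v nr"
      using X by (subst (asm) vec_norm2_eq_0_iff[of _ nr]) auto
    then have "(X *\<^sub>v unit_vec nc j) $ i = 0" using ij by simp
    then show ?thesis using X ij by simp
  qed
  then have "X = 0\<^sub>m nr nc" using X by (intro eq_matI) auto
  with assms show False by simp
qed

text \<open>The squared norm of \<open>t\<close> is the product of \<open>u\<close> with
  \<open>X *\<^sub>v conjugate t\<close>; Cauchy-Schwarz and division by the norm of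
  \<open>t\<close> finish. The conjugate appears because \<open>\<bullet>\<close> is bilinear. This
  carries block bounds from \<open>M\<close> over to its transpose.\<close>

lemma transpose_mult_bound:
  assumes X: "X \<in> carrier_mat nr nc"
    and c: "\<And>v. v \<in> carrier_vec nc \<Longrightarrow> vec_norm2 (X *\<^sub>v v) \<le> c * vec_norm2 v"
    and u: "u \<in> carrier_vec nr" and "0 \<le> c"
  shows "vec_norm2 (transpose_mat X *\<^sub>v u) \<le> c * vec_norm2 u"
proof -
  define t where "t = transpose_mat X *\<^sub>v u"
  have t: "t \<in> carrier_vec nc" using X u by (auto simp: t_def)
  have ct: "conjugate t \<in> carrier_vec nc" using t by simp
  have "complex_of_real ((vec_norm2 t)\<^sup>2) = t \<bullet> conjugate t"
    using scalar_prod_conjugate_self[of t] comm_scalar_prod[OF t ct] by simp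
  also have "\<dots> = u \<bullet> (X *\<^sub>v conjugate t)"
    unfolding t_def using X u ct by (subst transpose_vec_mult_scalar[OF X]) (auto simp: t_def)
  finally have "(vec_norm2 t)\<^sup>2 = cmod (u \<bullet> (X *\<^sub>v conjugate t))"
    by (metis norm_of_real abs_of_nonneg zero_le_power2)
  also have "\<dots> \<le> vec_norm2 u * vec_norm2 (X *\<^sub>v conjugate t)"
    using X u ct by (intro cmod_scalar_prod_le) auto
  also have "\<dots> \<le> vec_norm2 u * (c * vec_norm2 t)"
    using c[OF ct] by (intro mult_left_mono) auto
  finally have *: "vec_norm2 t * vec_norm2 t \<le> (c * vec_norm2 u) * vec_norm2 t"
    by (simp add: power2_eq_square ac_simps)
  show ?thesis
  proof (cases "vec_norm2 t = 0")
    case True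
    then show ?thesis using \<open>0 \<le> c\<close> by (simp add: t_def)
  next
    case False
    then have "0 < vec_norm2 t" by (simp add: less_le)
    then show ?thesis using * by (simp add: t_def)
  qed
qed

section \<open>Block partitions and Kronecker products with the identity\<close>

definition vec_block :: "nat \<Rightarrow> 'a Matrix.vec \<Rightarrow> nat \<Rightarrow> 'a Matrix.vec" where
  "vec_block n v k = vec n (\<lambda>r. v $ (k * n + r))"

lemma vec_block_carrier [simp]: "vec_block n v k \<in> carrier_vec n"
  by (simp add: vec_block_def)

lemma vec_block_index [simp]: "r < n \<Longrightarrow> vec_block n v k $ r = v $ (k * n + r)"
  by (simp add: vec_block_def)

lemma dim_vec_block [simp]: "dim_vec (vec_block n v k) = n"
  by (simp add: vec_block_def)

lemma block_index_less:
  fixes i r n N :: nat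
  assumes "i < N" "r < n"
  shows "i * n + r < N * n"
proof -
  have "i * n + r < Suc i * n" using assms by simp
  also have "\<dots> \<le> N * n" using assms by (intro mult_right_mono) auto
  finally show ?thesis .
qed

lemma block_index_div_mod:
  fixes i n N :: nat
  assumes "i < N * n"
  shows "i div n < N" "i mod n < n" "i = i div n * n + i mod n"
proof -
  show "i div n < N" using assms by (simp add: less_mult_imp_div_less)
  show "i mod n < n" using assms by (cases "n = 0") auto
qed simp

lemma eq_vec_blocksI:
  assumes "v \<in> carrier_vec (N * n)" "w \<in> carrier_vec (N * n)"
    and "\<And>i r. i < N \<Longrightarrow> r < n \<Longrightarrow> v $ (i * n + r) = w $ (i * n + r)"
  shows "v = w"
proof (rule eq_vecI)
  fix j assume "j < dim_vec w"
  with assms have "j < N * n" by simp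
  from block_index_div_mod[OF this] assms(3)[of "j div n" "j mod n"] show "v $ j = w $ j"
    by simp
qed (use assms in simp)

lemma sum_blocks:
  fixes f :: "nat \<Rightarrow> 'a::comm_monoid_add"
  shows "(\<Sum>i<N * n. f i) = (\<Sum>k<N. \<Sum>r<n. f (k * n + r))"
proof -
  have "(\<Sum>r<n. f (k * n + r)) = sum f {k * n..<k * n + n}" for k
    using sum.shift_bounds_nat_ivl[of f 0 "k * n" n] by (simp add: lessThan_atLeast0 add.commute)
  then show ?thesis by (simp add: sum.nat_group)
qed

lemma vec_norm2_blocks:
  assumes "v \<in> carrier_vec (N * n)"
  shows "(vec_norm2 v)\<^sup>2 = (\<Sum>k<N. (vec_norm2 (vec_block n v k))\<^sup>2)"
  using assms by (simp add: vec_norm2_square sum_blocks)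

lemma mat_block_carrier [simp]: "mat_block n X p q \<in> carrier_mat n n"
  by (simp add: mat_block_def)

lemma vec_block_mult:
  fixes X :: "'a::comm_semiring_0 mat"
  assumes X: "X \<in> carrier_mat (a * n) (b * n)" and v: "v \<in> carrier_vec (b * n)" and "k < a"
  shows "vec_block n (X *\<^sub>v v) k = vec n (\<lambda>r. \<Sum>q<b. (mat_block n X k q *\<^sub>v vec_block n v q) $ r)"
proof (rule eq_vecI)
  fix r assume "r < dim_vec (vec n (\<lambda>r. \<Sum>q<b. (mat_block n X k q *\<^sub>v vec_block n v q) $ r))"
  then have r: "r < n" by simp
  then have i: "k * n + r < a * n" using \<open>k < a\<close> by (rule block_index_less[rotated])
  have "(X *\<^sub>v v) $ (k * n + r) = (\<Sum>j<b * n. X $$ (k * n + r, j) * v $ j)"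
    using X v i by (auto simp: scalar_prod_def lessThan_atLeast0)
  also have "\<dots> = (\<Sum>q<b. \<Sum>s<n. X $$ (k * n + r, q * n + s) * v $ (q * n + s))"
    by (rule sum_blocks)
  also have "\<dots> = (\<Sum>q<b. (mat_block n X k q *\<^sub>v vec_block n v q) $ r)"
    using r by (intro sum.cong) (auto simp: scalar_prod_def lessThan_atLeast0 mat_block_def)
  finally show "vec_block n (X *\<^sub>v v) k $ r
      = vec n (\<lambda>r. \<Sum>q<b. (mat_block n X k q *\<^sub>v vec_block n v q) $ r) $ r"
    using r by simp
qed simp

lemma vec_norm2_block_mult_le:
  assumes X: "X \<in> carrier_mat (a * n) (b * n)" and v: "v \<in> carrier_vec (b * n)" and "k < a"
    and m: "\<And>q u. q < b \<Longrightarrow> u \<in> carrier_vec n \<Longrightarrow> vec_norm2 (mat_block n X k q *\<^sub>v u) \<le> m * vec_norm2 u"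
  shows "vec_norm2 (vec_block n (X *\<^sub>v v) k) \<le> m * (\<Sum>q<b. vec_norm2 (vec_block n v q))"
proof -
  have "vec_norm2 (vec_block n (X *\<^sub>v v) k)
      \<le> (\<Sum>q<b. vec_norm2 (mat_block n X k q *\<^sub>v vec_block n v q))"
    unfolding vec_block_mult[OF X v \<open>k < a\<close>]
    by (intro vec_norm2_sum) (auto intro: mult_mat_vec_carrier[OF mat_block_carrier])
  also have "\<dots> \<le> (\<Sum>q<b. m * vec_norm2 (vec_block n v q))"
    using m by (intro sum_mono) auto
  finally show ?thesis by (simp add: sum_distrib_left)
qed

text \<open>Each block of \<open>X *\<^sub>v v\<close> is at most \<open>m\<close> times the sum
  \<open>S\<close> of the block norms of \<open>v\<close>. Cauchy-Schwarz bounds the square of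
  \<open>S\<close> by \<open>N\<close> times that of the norm of \<open>v\<close>, and summing over
  the \<open>N\<close> block rows gives the second factor \<open>N\<close> under the root.\<close>

lemma spectral_norm_block_le:
  assumes X: "X \<in> carrier_mat (N * n) (N * n)" and "0 \<le> m"
    and m: "\<And>p q u. p < N \<Longrightarrow> q < N \<Longrightarrow> u \<in> carrier_vec n \<Longrightarrow>
      vec_norm2 (mat_block n X p q *\<^sub>v u) \<le> m * vec_norm2 u"
  shows "spectral_norm X \<le> m * real N"
proof (rule spectral_norm_le[OF X])
  fix v :: "complex Matrix.vec" assume v: "v \<in> carrier_vec (N * n)"
  define S where "S = (\<Sum>q<N. vec_norm2 (vec_block n v q))"
  \<comment> \<open>Cauchy-Schwarz against the constant family 1; the absolute values only match the
    form of that inequality.\<close>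
  have "S\<^sup>2 = (\<Sum>q<N. \<bar>vec_norm2 (vec_block n v q)\<bar> * \<bar>1\<bar>)\<^sup>2" by (simp add: S_def)
  also have "\<dots> \<le> (L2_set (\<lambda>q. vec_norm2 (vec_block n v q)) {..<N} * L2_set (\<lambda>_. 1) {..<N})\<^sup>2"
    by (intro power_mono L2_set_mult_ineq sum_nonneg) auto
  also have "\<dots> = real N * (vec_norm2 v)\<^sup>2"
    by (simp add: L2_set_def vec_norm2_blocks[OF v] power_mult_distrib sum_nonneg)
  finally have S: "S\<^sup>2 \<le> real N * (vec_norm2 v)\<^sup>2" .
  have "(vec_norm2 (X *\<^sub>v v))\<^sup>2 = (\<Sum>k<N. (vec_norm2 (vec_block n (X *\<^sub>v v) k))\<^sup>2)"
    by (rule vec_norm2_blocks[OF mult_mat_vec_carrier[OF X v]])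
  also have "\<dots> \<le> (\<Sum>k<N. (m * S)\<^sup>2)"
    unfolding S_def using m by (intro sum_mono power_mono vec_norm2_block_mult_le[OF X v]) auto
  also have "\<dots> = m\<^sup>2 * real N * S\<^sup>2" by (simp add: power_mult_distrib)
  also have "\<dots> \<le> m\<^sup>2 * real N * (real N * (vec_norm2 v)\<^sup>2)"
    using S by (intro mult_left_mono) auto
  also have "\<dots> = (m * real N * vec_norm2 v)\<^sup>2" by (simp add: power2_eq_square)
  finally show "vec_norm2 (X *\<^sub>v v) \<le> m * real N * vec_norm2 v"
    by (rule power2_le_imp_le) (use \<open>0 \<le> m\<close> in auto)
qed (use \<open>0 \<le> m\<close> in auto)

section \<open>Kronecker products with an identity matrix\<close>

lemma kronecker_one_carrier:
  "A \<in> carrier_mat a b \<Longrightarrow> kronecker A (1\<^sub>m n) \<in> carrier_mat (a * n) (b * n)"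
  by (auto simp: kronecker_def)

lemma kronecker_one_index:
  fixes A :: "'a::comm_ring_1 mat"
  assumes A: "A \<in> carrier_mat a b" and "i < a" "j < b" "r < n" "s < n"
  shows "kronecker A (1\<^sub>m n) $$ (i * n + r, j * n + s) = (if r = s then A $$ (i, j) else 0)"
  using assms block_index_less[OF \<open>i < a\<close> \<open>r < n\<close>] block_index_less[OF \<open>j < b\<close> \<open>s < n\<close>]
  by (simp add: kronecker_def)

text \<open>Blocks of the product are scalar, so different positions \<open>r\<close> inside a block
  never mix, and \<open>A\<close> acts on the entries at each position separately.\<close>

lemma kronecker_one_mult_vec:
  fixes A :: "'a::comm_ring_1 mat"
  assumes A: "A \<in> carrier_mat a b" and u: "u \<in> carrier_vec (b * n)" and "i < a" "r < n"
  shows "(kronecker A (1\<^sub>m n) *\<^sub>v u) $ (i * n + r) = (\<Sum>j<b. A $$ (i, j) * u $ (j * n + r))"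
proof -
  note K = kronecker_one_carrier[OF A, of n]
  have "(kronecker A (1\<^sub>m n) *\<^sub>v u) $ (i * n + r)
      = (\<Sum>k<b * n. kronecker A (1\<^sub>m n) $$ (i * n + r, k) * u $ k)"
    using K u block_index_less[OF \<open>i < a\<close> \<open>r < n\<close>]
    by (auto simp: scalar_prod_def lessThan_atLeast0)
  also have "\<dots> = (\<Sum>j<b. \<Sum>s<n. (if r = s then A $$ (i, j) else 0) * u $ (j * n + s))"
    unfolding sum_blocks using assms by (intro sum.cong refl) (simp add: kronecker_one_index[OF A])
  also have "\<dots> = (\<Sum>j<b. A $$ (i, j) * u $ (j * n + r))"
    using \<open>r < n\<close> by (simp add: if_distrib[of "\<lambda>c. c * _"] cong: if_cong)
  finally show ?thesis .
qed

lemma transpose_kronecker_one: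
  "transpose_mat (kronecker A (1\<^sub>m n)) = kronecker (transpose_mat A) (1\<^sub>m n :: 'a::comm_ring_1 mat)"
  by (rule eq_matI) (auto simp: kronecker_def less_mult_imp_div_less dest: block_index_div_mod(2))

section \<open>The block Kronecker pencil\<close>

lemma L_mat_carrier: "L_mat k q \<in> carrier_mat k (k + 1)"
  by (simp add: L_mat_def)

lemma Lambda_mat_carrier: "Lambda_mat k q \<in> carrier_mat (k + 1) 1"
  by (simp add: Lambda_mat_def)

lemma L_mult_index:
  assumes u: "u \<in> carrier_vec ((k + 1) * n)" and i: "i < k" and r: "r < n"
  shows "(kronecker (L_mat k q) (1\<^sub>m n) *\<^sub>v u) $ (i * n + r)
    = q * u $ (Suc i * n + r) - u $ (i * n + r)"
proof -
  have "(kronecker (L_mat k q) (1\<^sub>m n) *\<^sub>v u) $ (i * n + r)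
      = (\<Sum>j<k + 1. (if j = i then - u $ (j * n + r) else 0) + (if j = Suc i then q * u $ (j * n + r) else 0))"
    unfolding kronecker_one_mult_vec[OF L_mat_carrier u i r]
    using i by (intro sum.cong) (auto simp: L_mat_def)
  also have "\<dots> = q * u $ (Suc i * n + r) - u $ (i * n + r)"
    using i by (simp add: sum.distrib del: sum.lessThan_Suc)
  finally show ?thesis .
qed

text \<open>Column \<open>i\<close> of \<open>L_mat k q\<close> has -1 in row \<open>i\<close> and
  \<open>q\<close> in row \<open>i - 1\<close>; for \<open>i = k\<close> or \<open>i = 0\<close> one
  of these rows does not exist. The two truncated cases later start the recursion for
  \<open>u\<close> from either end.\<close>

lemma transpose_L_mult_index:
  assumes u: "u \<in> carrier_vec (k * n)" and i: "i \<le> k" and r: "r < n"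
  shows "(kronecker (transpose_mat (L_mat k q)) (1\<^sub>m n) *\<^sub>v u) $ (i * n + r)
    = (if 0 < i then q * u $ ((i - 1) * n + r) else 0) - (if i < k then u $ (i * n + r) else 0)"
proof -
  have T: "transpose_mat (L_mat k q) \<in> carrier_mat (k + 1) k"
    using L_mat_carrier by simp
  have "i < k + 1" using i by simp
  then have "(kronecker (transpose_mat (L_mat k q)) (1\<^sub>m n) *\<^sub>v u) $ (i * n + r)
      = (\<Sum>j<k. transpose_mat (L_mat k q) $$ (i, j) * u $ (j * n + r))"
    by (rule kronecker_one_mult_vec[OF T u _ r])
  also have "\<dots> = (\<Sum>j<k. (if j = i then - u $ (j * n + r) else 0)
      + (if 0 < i \<and> j = i - 1 then q * u $ (j * n + r) else 0))"
    using i by (intro sum.cong) (auto simp: L_mat_def)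
  also have "\<dots> = (if 0 < i then q * u $ ((i - 1) * n + r) else 0) - (if i < k then u $ (i * n + r) else 0)"
    using i by (cases "0 < i") (auto simp: sum.distrib)
  finally show ?thesis .
qed

lemma Lambda_mult_index:
  assumes "x \<in> carrier_vec n" "i \<le> k" "r < n"
  shows "(kronecker (Lambda_mat k q) (1\<^sub>m n) *\<^sub>v x) $ (i * n + r) = q ^ (k - i) * x $ r"
  using kronecker_one_mult_vec[OF Lambda_mat_carrier, of x n i k r q] assms
  by (simp add: Lambda_mat_def)

lemma Lambda_mult_carrier:
  "x \<in> carrier_vec n \<Longrightarrow> kronecker (Lambda_mat k q) (1\<^sub>m n) *\<^sub>v x \<in> carrier_vec ((k + 1) * n)"
  using kronecker_one_carrier[OF Lambda_mat_carrier, of k q n] by auto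

text \<open>Each block of the inner vector is \<open>q\<close> times the next one, so the two
  nonzero entries in a row of \<open>L_mat k q\<close> cancel.\<close>

lemma L_Lambda_mult:
  assumes x: "x \<in> carrier_vec n"
  shows "kronecker (L_mat k q) (1\<^sub>m n) *\<^sub>v (kronecker (Lambda_mat k q) (1\<^sub>m n) *\<^sub>v x) = 0\<^sub>v (k * n)"
    (is "?K *\<^sub>v ?u = _")
proof (rule eq_vec_blocksI)
  fix i r assume i: "i < k" and r: "r < n"
  have "q * q ^ (k - Suc i) = q ^ (k - i)"
    using i by (metis Suc_diff_Suc power_Suc)
  then show "(?K *\<^sub>v ?u) $ (i * n + r) = 0\<^sub>v (k * n) $ (i * n + r)"
    using i r x block_index_less[OF i r]
    by (subst L_mult_index[OF Lambda_mult_carrier[OF x] i r])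
      (simp del: mult_Suc add: Lambda_mult_index mult.assoc[symmetric])
qed (rule mult_mat_vec_carrier[OF kronecker_one_carrier[OF L_mat_carrier] Lambda_mult_carrier[OF x]], simp)

text \<open>The matrix of \<open>block_kronecker_lification\<close> with any polynomial
  \<open>q\<close> in place of the power of the variable. With \<open>\<epsilon>\<close>,
  \<open>\<eta>\<close> and \<open>M\<close> as arguments, transposition becomes an exchange of
  arguments.\<close>

definition kronecker_pencil ::
  "nat \<Rightarrow> nat \<Rightarrow> nat \<Rightarrow> complex poly \<Rightarrow> complex poly mat \<Rightarrow> complex poly mat" where
  "kronecker_pencil \<epsilon> n \<eta> q M =
     four_block_mat M (kronecker (transpose_mat (L_mat \<eta> q)) (1\<^sub>m n))
       (kronecker (L_mat \<epsilon> q) (1\<^sub>m n)) (0\<^sub>m (\<epsilon> * n) (\<eta> * n))"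

lemma kronecker_L_carriers:
  "kronecker (L_mat k q) (1\<^sub>m n) \<in> carrier_mat (k * n) ((k + 1) * n)"
  "kronecker (transpose_mat (L_mat k q)) (1\<^sub>m n) \<in> carrier_mat ((k + 1) * n) (k * n)"
  by (intro kronecker_one_carrier L_mat_carrier transpose_carrier_mat[THEN iffD2])+

lemma kronecker_pencil_carrier:
  assumes "M \<in> carrier_mat ((\<eta> + 1) * n) ((\<epsilon> + 1) * n)"
  shows "kronecker_pencil \<epsilon> n \<eta> q M
    \<in> carrier_mat ((\<eta> + 1) * n + \<epsilon> * n) ((\<epsilon> + 1) * n + \<eta> * n)"
  unfolding kronecker_pencil_def using assms by (intro four_block_carrier_mat) auto

text \<open>By this symmetry a left null vector can be treated as a right null vector of a pencil of
  the same kind.\<close>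

lemma transpose_kronecker_pencil:
  assumes "M \<in> carrier_mat ((\<eta> + 1) * n) ((\<epsilon> + 1) * n)"
  shows "transpose_mat (kronecker_pencil \<epsilon> n \<eta> q M) = kronecker_pencil \<eta> n \<epsilon> q (transpose_mat M)"
  unfolding kronecker_pencil_def
  by (subst transpose_four_block_mat[OF assms kronecker_L_carriers(2,1) zero_carrier_mat])
    (simp add: transpose_kronecker_one)

text \<open>The trailing parts \<open>t\<close> and \<open>u\<close> drop out because $L_k \Lambda_k = 0$.\<close>

lemma kronecker_pencil_sandwich:
  fixes x y u t :: "complex poly Matrix.vec"
  assumes M: "M \<in> carrier_mat ((\<eta> + 1) * n) ((\<epsilon> + 1) * n)"
    and P: "P = kronecker (transpose_mat (Lambda_mat \<eta> q)) (1\<^sub>m n) * M * kronecker (Lambda_mat \<epsilon> q) (1\<^sub>m n)"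
    and x: "x \<in> carrier_vec n" and y: "y \<in> carrier_vec n"
    and u: "u \<in> carrier_vec (\<eta> * n)" and t: "t \<in> carrier_vec (\<epsilon> * n)"
  shows "((kronecker (Lambda_mat \<eta> q) (1\<^sub>m n) *\<^sub>v y) @\<^sub>v t) \<bullet>
      (kronecker_pencil \<epsilon> n \<eta> q M *\<^sub>v ((kronecker (Lambda_mat \<epsilon> q) (1\<^sub>m n) *\<^sub>v x) @\<^sub>v u))
    = y \<bullet> (P *\<^sub>v x)"
proof -
  define Y where "Y = kronecker (Lambda_mat \<eta> q) (1\<^sub>m n) *\<^sub>v y"
  define X where "X = kronecker (Lambda_mat \<epsilon> q) (1\<^sub>m n) *\<^sub>v x"
  define K where "K = kronecker (transpose_mat (L_mat \<eta> q)) (1\<^sub>m n)"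
  define J where "J = kronecker (L_mat \<epsilon> q) (1\<^sub>m n)"
  note defs = Y_def X_def K_def J_def
  have Y: "Y \<in> carrier_vec ((\<eta> + 1) * n)" and X: "X \<in> carrier_vec ((\<epsilon> + 1) * n)"
    unfolding defs using x y Lambda_mult_carrier by blast+
  have K: "K \<in> carrier_mat ((\<eta> + 1) * n) (\<eta> * n)" and J: "J \<in> carrier_mat (\<epsilon> * n) ((\<epsilon> + 1) * n)"
    unfolding defs by (rule kronecker_L_carriers)+
  have MX: "M *\<^sub>v X \<in> carrier_vec ((\<eta> + 1) * n)" and Ku: "K *\<^sub>v u \<in> carrier_vec ((\<eta> + 1) * n)"
    using M X K u by (auto simp del: add_mult_distrib)
  have "kronecker_pencil \<epsilon> n \<eta> q M *\<^sub>v (X @\<^sub>v u)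
      = (M *\<^sub>v X + K *\<^sub>v u) @\<^sub>v (J *\<^sub>v X + 0\<^sub>m (\<epsilon> * n) (\<eta> * n) *\<^sub>v u)"
    unfolding kronecker_pencil_def K_def[symmetric] J_def[symmetric]
    by (rule four_block_mat_mult_vec[OF M K J _ X u]) simp
  also have "J *\<^sub>v X + 0\<^sub>m (\<epsilon> * n) (\<eta> * n) *\<^sub>v u = 0\<^sub>v (\<epsilon> * n)"
    unfolding J_def X_def L_Lambda_mult[OF x] using u by auto
  finally have "(Y @\<^sub>v t) \<bullet> (kronecker_pencil \<epsilon> n \<eta> q M *\<^sub>v (X @\<^sub>v u))
      = Y \<bullet> (M *\<^sub>v X + K *\<^sub>v u) + t \<bullet> 0\<^sub>v (\<epsilon> * n)"
    using scalar_prod_append[OF Y t] MX Ku by simp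
  also have "\<dots> = Y \<bullet> (M *\<^sub>v X) + Y \<bullet> (K *\<^sub>v u)"
    using t scalar_prod_add_distrib[OF Y MX Ku] by simp
  \<comment> \<open>Moved to the other factor, \<open>K\<close> turns into the block built from
    \<open>L_mat \<eta> q\<close> and annihilates \<open>Y\<close>.\<close>
  also have "Y \<bullet> (K *\<^sub>v u) = (transpose_mat K *\<^sub>v Y) \<bullet> u"
    by (rule transpose_vec_mult_scalar[symmetric, OF K u Y])
  also have "transpose_mat K *\<^sub>v Y = 0\<^sub>v (\<eta> * n)"
    unfolding K_def transpose_kronecker_one Y_def using L_Lambda_mult[OF y] by simp
  also have "0\<^sub>v (\<eta> * n) \<bullet> u = 0" using u by simp
  also have "Y \<bullet> (M *\<^sub>v X) = y \<bullet> (P *\<^sub>v x)"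
  proof -
    define A where "A = kronecker (Lambda_mat \<eta> q) (1\<^sub>m n)"
    define B where "B = kronecker (Lambda_mat \<epsilon> q) (1\<^sub>m n)"
    have A: "A \<in> carrier_mat ((\<eta> + 1) * n) n" and B: "B \<in> carrier_mat ((\<epsilon> + 1) * n) n"
      unfolding A_def B_def
      using kronecker_one_carrier[OF Lambda_mat_carrier, of _ _ n] by simp_all
    have "P *\<^sub>v x = transpose_mat A *\<^sub>v (M *\<^sub>v X)"
      unfolding P A_def[symmetric] B_def[symmetric] X_def transpose_kronecker_one[symmetric]
      using A M B x
      by (subst assoc_mult_mat_vec[of _ n "(\<epsilon> + 1) * n" _ n], simp_all del: add_mult_distrib mult_Suc add_mult_distrib2)
    then show ?thesis
      using transpose_vec_mult_scalar[OF A y MX] comm_scalar_prod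
      using A M X y by (metis A_def MX P Y Y_def mult_mat_vec_carrier transpose_carrier_mat)
  qed
  finally show ?thesis by (simp add: X_def Y_def)
qed

section \<open>Evaluation, derivatives and null vectors\<close>

abbreviation vec_eval :: "complex poly Matrix.vec \<Rightarrow> complex \<Rightarrow> complex Matrix.vec" where
  "vec_eval V z \<equiv> map_vec (\<lambda>p. poly p z) V"

text \<open>Vectors of numbers become constant polynomials, so that bilinear identities hold between
  polynomials and can be differentiated.\<close>

abbreviation const_vec :: "complex Matrix.vec \<Rightarrow> complex poly Matrix.vec" where
  "const_vec v \<equiv> map_vec (\<lambda>c. [:c:]) v"

lemma vec_eval_const [simp]: "vec_eval (const_vec v) z = v"
  by (rule eq_vecI) auto

lemma vec_eval_append: "vec_eval (U @\<^sub>v V) z = vec_eval U z @\<^sub>v vec_eval V z"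
  by (rule eq_vecI) auto

lemma mat_poly_eval_carrier: "A \<in> carrier_mat nr nc \<Longrightarrow> mat_poly_eval A z \<in> carrier_mat nr nc"
  by (auto simp: mat_poly_eval_def)

lemma mat_poly_deriv_carrier: "A \<in> carrier_mat nr nc \<Longrightarrow> mat_poly_deriv A \<in> carrier_mat nr nc"
  by (auto simp: mat_poly_deriv_def)

lemma mat_poly_coeff_carrier: "A \<in> carrier_mat nr nc \<Longrightarrow> mat_poly_coeff A i \<in> carrier_mat nr nc"
  by (auto simp: mat_poly_coeff_def)

lemma bilinear_sum:
  fixes A :: "'a::comm_semiring_0 mat"
  assumes "W \<in> carrier_vec nr" "A \<in> carrier_mat nr nc" "V \<in> carrier_vec nc"
  shows "W \<bullet> (A *\<^sub>v V) = (\<Sum>i<nr. \<Sum>j<nc. W $ i * (A $$ (i, j) * V $ j))"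
  using assms by (auto simp: scalar_prod_def lessThan_atLeast0 sum_distrib_left intro!: sum.cong)

lemma vec_eval_mult:
  assumes "A \<in> carrier_mat nr nc" "V \<in> carrier_vec nc"
  shows "vec_eval (A *\<^sub>v V) z = mat_poly_eval A z *\<^sub>v vec_eval V z"
  using assms
  by (intro eq_vecI) (auto simp: mat_poly_eval_def scalar_prod_def poly_sum intro!: sum.cong)

lemma poly_bilinear:
  assumes "W \<in> carrier_vec nr" "A \<in> carrier_mat nr nc" "V \<in> carrier_vec nc"
  shows "poly (W \<bullet> (A *\<^sub>v V)) z = vec_eval W z \<bullet> (mat_poly_eval A z *\<^sub>v vec_eval V z)"
proof -
  have "vec_eval W z \<in> carrier_vec nr" "vec_eval V z \<in> carrier_vec nc" using assms by auto
  note * = bilinear_sum[OF this(1) mat_poly_eval_carrier[OF assms(2)] this(2), of z]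
  show ?thesis unfolding bilinear_sum[OF assms] *
    using assms by (auto simp: poly_sum mat_poly_eval_def intro!: sum.cong)
qed

lemmas pderiv_sum_distrib = higher_pderiv_sum[where n = 1, simplified]

text \<open>The product rule gives three terms. Where \<open>W\<close> or \<open>V\<close> is
  differentiated, the other factor is still a null vector of the evaluated matrix or of its
  transpose, so the term vanishes, and only the derivative of \<open>A\<close> survives.\<close>

lemma pderiv_bilinear:
  assumes W: "W \<in> carrier_vec nr" and A: "A \<in> carrier_mat nr nc" and V: "V \<in> carrier_vec nc"
    and right: "mat_poly_eval A z *\<^sub>v vec_eval V z = 0\<^sub>v nr"
    and left: "transpose_mat (mat_poly_eval A z) *\<^sub>v vec_eval W z = 0\<^sub>v nc"
  shows "poly (pderiv (W \<bullet> (A *\<^sub>v V))) z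
    = vec_eval W z \<bullet> (mat_poly_eval (mat_poly_deriv A) z *\<^sub>v vec_eval V z)"
proof -
  define W' where "W' = map_vec pderiv W"
  define V' where "V' = map_vec pderiv V"
  note dims = W A V
  have W': "W' \<in> carrier_vec nr" and V': "V' \<in> carrier_vec nc" using W V by (auto simp: W'_def V'_def)
  note A' = mat_poly_deriv_carrier[OF A]
  have "poly (pderiv (W \<bullet> (A *\<^sub>v V))) z
      = poly (W' \<bullet> (A *\<^sub>v V)) z + poly (W \<bullet> (mat_poly_deriv A *\<^sub>v V)) z + poly (W \<bullet> (A *\<^sub>v V')) z"
    unfolding bilinear_sum[OF dims] bilinear_sum[OF W' A V] bilinear_sum[OF W A' V] bilinear_sum[OF W A V']
    using W A V
    by (simp add: pderiv_sum_distrib pderiv_mult W'_def V'_def mat_poly_deriv_def poly_sum algebra_simps sum.distrib)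
  also have "poly (W' \<bullet> (A *\<^sub>v V)) z = 0"
    unfolding poly_bilinear[OF W' A V] right using W' by simp
  also have "poly (W \<bullet> (A *\<^sub>v V')) z = (transpose_mat (mat_poly_eval A z) *\<^sub>v vec_eval W z) \<bullet> vec_eval V' z"
    unfolding poly_bilinear[OF W A V']
    using W V' by (intro transpose_vec_mult_scalar[symmetric, OF mat_poly_eval_carrier[OF A]]) auto
  also have "\<dots> = 0" unfolding left using V' by simp
  also have "poly (W \<bullet> (mat_poly_deriv A *\<^sub>v V)) z
      = vec_eval W z \<bullet> (mat_poly_eval (mat_poly_deriv A) z *\<^sub>v vec_eval V z)"
    by (rule poly_bilinear[OF W A' V])
  finally show ?thesis by simp
qed

text \<open>\<open>Lambda_vec k s x\<close> is $\Lambda_k(s) \otimes x$.\<close>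

definition Lambda_vec :: "nat \<Rightarrow> complex \<Rightarrow> complex Matrix.vec \<Rightarrow> complex Matrix.vec" where
  "Lambda_vec k s x = vec ((k + 1) * dim_vec x) (\<lambda>i. s ^ (k - i div dim_vec x) * x $ (i mod dim_vec x))"

lemma Lambda_vec_carrier: "x \<in> carrier_vec n \<Longrightarrow> Lambda_vec k s x \<in> carrier_vec ((k + 1) * n)"
  by (auto simp: Lambda_vec_def)

lemma Lambda_vec_index:
  assumes "x \<in> carrier_vec n" "i \<le> k" "r < n"
  shows "Lambda_vec k s x $ (i * n + r) = s ^ (k - i) * x $ r"
  using assms block_index_less[of i "k + 1" r n] by (simp add: Lambda_vec_def)

lemma vec_eval_Lambda_mult:
  assumes x: "x \<in> carrier_vec n"
  shows "vec_eval (kronecker (Lambda_mat k q) (1\<^sub>m n) *\<^sub>v const_vec x) z = Lambda_vec k (poly q z) x"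
    (is "?l = ?r")
proof (rule eq_vec_blocksI)
  have *: "const_vec x \<in> carrier_vec n" using x by simp
  show "?l \<in> carrier_vec ((k + 1) * n)" using Lambda_mult_carrier[OF *] by simp
  show "?r \<in> carrier_vec ((k + 1) * n)" by (rule Lambda_vec_carrier[OF x])
  fix i r assume i: "i < k + 1" and r: "r < n"
  have "?l $ (i * n + r) = poly ((kronecker (Lambda_mat k q) (1\<^sub>m n) *\<^sub>v const_vec x) $ (i * n + r)) z"
    using carrier_vecD[OF Lambda_mult_carrier[OF *]] block_index_less[OF i r]
    by (intro index_map_vec) (simp only:)
  with i r x show "?l $ (i * n + r) = ?r $ (i * n + r)"
    by (simp add: Lambda_mult_index[OF *] Lambda_vec_index)
qed

text \<open>Both parts read off \<open>kronecker_pencil_sandwich\<close>. Evaluated at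
  \<open>z\<close> with arbitrary \<open>y\<close>, it shows that every \<open>y\<close> pairs to 0
  with P(z) x. Differentiated at \<open>z\<close>, with null vectors on both sides, it identifies
  the denominators of the two condition numbers.\<close>

lemma kronecker_pencil_deriv:
  assumes M: "M \<in> carrier_mat ((\<eta> + 1) * n) ((\<epsilon> + 1) * n)"
    and P: "P = kronecker (transpose_mat (Lambda_mat \<eta> q)) (1\<^sub>m n) * M * kronecker (Lambda_mat \<epsilon> q) (1\<^sub>m n)"
    and P_carrier: "P \<in> carrier_mat n n"
    and x: "x \<in> carrier_vec n" and y: "y \<in> carrier_vec n"
    and u: "u \<in> carrier_vec (\<eta> * n)" and t: "t \<in> carrier_vec (\<epsilon> * n)"
    and s: "s = poly q z"
    and right: "mat_poly_eval (kronecker_pencil \<epsilon> n \<eta> q M) z *\<^sub>v (Lambda_vec \<epsilon> s x @\<^sub>v u)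
      = 0\<^sub>v ((\<eta> + 1) * n + \<epsilon> * n)"
  shows "mat_poly_eval P z *\<^sub>v x = 0\<^sub>v n"
    and "transpose_mat (mat_poly_eval (kronecker_pencil \<epsilon> n \<eta> q M) z) *\<^sub>v (Lambda_vec \<eta> s y @\<^sub>v t)
        = 0\<^sub>v ((\<epsilon> + 1) * n + \<eta> * n) \<Longrightarrow>
      (Lambda_vec \<eta> s y @\<^sub>v t) \<bullet>
        (mat_poly_eval (mat_poly_deriv (kronecker_pencil \<epsilon> n \<eta> q M)) z *\<^sub>v (Lambda_vec \<epsilon> s x @\<^sub>v u))
      = y \<bullet> (mat_poly_eval (mat_poly_deriv P) z *\<^sub>v x)"
proof -
  define A where "A = kronecker_pencil \<epsilon> n \<eta> q M"
  define V where "V = (kronecker (Lambda_mat \<epsilon> q) (1\<^sub>m n) *\<^sub>v const_vec x) @\<^sub>v const_vec u"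
  \<comment> \<open>\<open>W\<close> is a function because it is used first with unit vectors and
    then with the given \<open>y\<close>.\<close>
  define W where "W = (\<lambda>y. (kronecker (Lambda_mat \<eta> q) (1\<^sub>m n) *\<^sub>v const_vec y) @\<^sub>v const_vec t)"
  have A: "A \<in> carrier_mat ((\<eta> + 1) * n + \<epsilon> * n) ((\<epsilon> + 1) * n + \<eta> * n)"
    unfolding A_def by (rule kronecker_pencil_carrier[OF M])
  have V: "V \<in> carrier_vec ((\<epsilon> + 1) * n + \<eta> * n)"
    unfolding V_def using x u by (intro append_carrier_vec Lambda_mult_carrier) auto
  have W: "W y \<in> carrier_vec ((\<eta> + 1) * n + \<epsilon> * n)" if "y \<in> carrier_vec n" for y
    unfolding W_def using that t by (intro append_carrier_vec Lambda_mult_carrier) auto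
  have eV: "vec_eval V z = Lambda_vec \<epsilon> s x @\<^sub>v u"
    unfolding V_def vec_eval_append vec_eval_Lambda_mult[OF x] by (simp add: s)
  have eW: "vec_eval (W y) z = Lambda_vec \<eta> s y @\<^sub>v t" if "y \<in> carrier_vec n" for y
    unfolding W_def vec_eval_append vec_eval_Lambda_mult[OF that] by (simp add: s)
  have cx: "const_vec x \<in> carrier_vec n" using x by simp
  have sandwich: "W y \<bullet> (A *\<^sub>v V) = const_vec y \<bullet> (P *\<^sub>v const_vec x)" if "y \<in> carrier_vec n" for y
    unfolding A_def V_def W_def using x that u t by (intro kronecker_pencil_sandwich[OF M P]) auto
  note right' = right[folded A_def eV]
  have prod0: "y \<bullet> (mat_poly_eval P z *\<^sub>v x) = 0" if y: "y \<in> carrier_vec n" for y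
  proof -
    have cy: "const_vec y \<in> carrier_vec n" using y by simp
    have "y \<bullet> (mat_poly_eval P z *\<^sub>v x) = poly (const_vec y \<bullet> (P *\<^sub>v const_vec x)) z"
      unfolding poly_bilinear[OF cy P_carrier cx] by simp
    also have "\<dots> = vec_eval (W y) z \<bullet> (mat_poly_eval A z *\<^sub>v vec_eval V z)"
      unfolding sandwich[OF y, symmetric] by (rule poly_bilinear[OF W[OF y] A V])
    also have "\<dots> = 0" unfolding right' using W[OF y] by simp
    finally show ?thesis .
  qed
  have Px: "mat_poly_eval P z *\<^sub>v x \<in> carrier_vec n"
    by (rule mult_mat_vec_carrier[OF mat_poly_eval_carrier[OF P_carrier] x])
  show Px0: "mat_poly_eval P z *\<^sub>v x = 0\<^sub>v n"
  proof (rule eq_vecI)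
    fix i assume "i < dim_vec (0\<^sub>v n :: complex Matrix.vec)"
    then show "(mat_poly_eval P z *\<^sub>v x) $ i = 0\<^sub>v n $ i"
      using prod0[of "unit_vec n i"] scalar_prod_left_unit[OF Px, of i] by simp
  qed (use carrier_vecD[OF Px] in simp)
  assume left: "transpose_mat (mat_poly_eval (kronecker_pencil \<epsilon> n \<eta> q M) z) *\<^sub>v (Lambda_vec \<eta> s y @\<^sub>v t)
        = 0\<^sub>v ((\<epsilon> + 1) * n + \<eta> * n)"
  have "(Lambda_vec \<eta> s y @\<^sub>v t) \<bullet> (mat_poly_eval (mat_poly_deriv A) z *\<^sub>v (Lambda_vec \<epsilon> s x @\<^sub>v u))
      = poly (pderiv (W y \<bullet> (A *\<^sub>v V))) z"
    unfolding eV[symmetric] eW[OF y, symmetric]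
    by (rule pderiv_bilinear[symmetric, OF W[OF y] A V right'])
      (use left in \<open>simp add: A_def eW[OF y]\<close>)
  \<comment> \<open>The sandwich identity holds between polynomials and so survives differentiation;
    on its other side \<open>x\<close> and \<open>y\<close> are constant and only the entries of
    \<open>P\<close> are differentiated.\<close>
  also have "\<dots> = y \<bullet> (mat_poly_eval (mat_poly_deriv P) z *\<^sub>v x)"
    unfolding sandwich[OF y] bilinear_sum[OF map_carrier_vec[THEN iffD2, OF y] P_carrier cx]
      bilinear_sum[OF y mat_poly_eval_carrier[OF mat_poly_deriv_carrier[OF P_carrier]] x]
    using x y P_carrier
    by (simp add: pderiv_sum_distrib pderiv_smult ac_simps poly_sum mat_poly_deriv_def mat_poly_eval_def)
  finally show "(Lambda_vec \<eta> s y @\<^sub>v t) \<bullet>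
        (mat_poly_eval (mat_poly_deriv (kronecker_pencil \<epsilon> n \<eta> q M)) z *\<^sub>v (Lambda_vec \<epsilon> s x @\<^sub>v u))
      = y \<bullet> (mat_poly_eval (mat_poly_deriv P) z *\<^sub>v x)"
    by (simp add: A_def)
qed

text \<open>The lower block rows say that each block of the first part of \<open>v\<close> is
  \<open>s\<close> times the next, which forces the form \<open>Lambda_vec \<epsilon> s x\<close>
  with \<open>x\<close> the last block. The upper block rows then become a recursion for the blocks
  of \<open>u\<close>.\<close>

lemma kronecker_pencil_kernel:
  assumes M: "M \<in> carrier_mat ((\<eta> + 1) * n) ((\<epsilon> + 1) * n)"
    and s: "s = poly q z"
    and v: "v \<in> carrier_vec ((\<epsilon> + 1) * n + \<eta> * n)"
    and kernel: "mat_poly_eval (kronecker_pencil \<epsilon> n \<eta> q M) z *\<^sub>v v = 0\<^sub>v ((\<eta> + 1) * n + \<epsilon> * n)"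
  obtains x u where "x \<in> carrier_vec n" "u \<in> carrier_vec (\<eta> * n)" "v = Lambda_vec \<epsilon> s x @\<^sub>v u"
    "\<And>i r. i \<le> \<eta> \<Longrightarrow> r < n \<Longrightarrow> (mat_poly_eval M z *\<^sub>v Lambda_vec \<epsilon> s x) $ (i * n + r)
       = (if i < \<eta> then u $ (i * n + r) else 0) - (if 0 < i then s * u $ ((i - 1) * n + r) else 0)"
proof -
  define v1 where "v1 = vec_first v ((\<epsilon> + 1) * n)"
  define u where "u = vec_last v (\<eta> * n)"
  define x where "x = vec_block n v1 \<epsilon>"
  define K where "K = kronecker (transpose_mat (L_mat \<eta> q)) (1\<^sub>m n)"
  define J where "J = kronecker (L_mat \<epsilon> q) (1\<^sub>m n)"
  have v_eq: "v = v1 @\<^sub>v u" using vec_first_last_append[OF v] by (simp add: v1_def u_def)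
  have v1: "v1 \<in> carrier_vec ((\<epsilon> + 1) * n)" and u: "u \<in> carrier_vec (\<eta> * n)"
    unfolding v1_def u_def by auto
  have x: "x \<in> carrier_vec n" by (simp add: x_def)
  have K: "K \<in> carrier_mat ((\<eta> + 1) * n) (\<eta> * n)" and J: "J \<in> carrier_mat (\<epsilon> * n) ((\<epsilon> + 1) * n)"
    unfolding K_def J_def by (rule kronecker_L_carriers)+
  note ev = mat_poly_eval_carrier
  have cu: "const_vec u \<in> carrier_vec (\<eta> * n)" and cv1: "const_vec v1 \<in> carrier_vec ((\<epsilon> + 1) * n)"
    using u v1 by (auto simp del: add_mult_distrib)
  have "mat_poly_eval (kronecker_pencil \<epsilon> n \<eta> q M) z
      = four_block_mat (mat_poly_eval M z) (mat_poly_eval K z) (mat_poly_eval J z) (0\<^sub>m (\<epsilon> * n) (\<eta> * n))"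
    unfolding kronecker_pencil_def K_def[symmetric] J_def[symmetric] mat_poly_eval_def
    by (subst map_four_block_mat[OF M K J zero_carrier_mat]) (auto intro!: arg_cong[of _ _ "four_block_mat _ _ _"])
  then have "mat_poly_eval (kronecker_pencil \<epsilon> n \<eta> q M) z *\<^sub>v v
      = (mat_poly_eval M z *\<^sub>v v1 + mat_poly_eval K z *\<^sub>v u) @\<^sub>v
        (mat_poly_eval J z *\<^sub>v v1 + 0\<^sub>m (\<epsilon> * n) (\<eta> * n) *\<^sub>v u)"
    unfolding v_eq using four_block_mat_mult_vec[OF ev[OF M] ev[OF K] ev[OF J] zero_carrier_mat v1 u]
    by simp
  moreover have "0\<^sub>v ((\<eta> + 1) * n + \<epsilon> * n) = 0\<^sub>v ((\<eta> + 1) * n) @\<^sub>v (0\<^sub>v (\<epsilon> * n) :: complex Matrix.vec)"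
    by (rule eq_vecI) auto
  moreover have Mv: "mat_poly_eval M z *\<^sub>v v1 \<in> carrier_vec ((\<eta> + 1) * n)"
    by (rule mult_mat_vec_carrier[OF ev[OF M] v1])
  moreover have Kv: "mat_poly_eval K z *\<^sub>v u \<in> carrier_vec ((\<eta> + 1) * n)"
    by (rule mult_mat_vec_carrier[OF ev[OF K] u])
  moreover have Jv: "mat_poly_eval J z *\<^sub>v v1 \<in> carrier_vec (\<epsilon> * n)"
    by (rule mult_mat_vec_carrier[OF ev[OF J] v1])
  moreover have "0\<^sub>m (\<epsilon> * n) (\<eta> * n) *\<^sub>v u = 0\<^sub>v (\<epsilon> * n)" using u by auto
  ultimately have top: "mat_poly_eval M z *\<^sub>v v1 + mat_poly_eval K z *\<^sub>v u = 0\<^sub>v ((\<eta> + 1) * n)"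
    and bot: "mat_poly_eval J z *\<^sub>v v1 = 0\<^sub>v (\<epsilon> * n)"
    using kernel append_vec_eq[OF add_carrier_vec[OF Mv Kv] zero_carrier_vec] by auto
  have rec: "v1 $ (i * n + r) = s * v1 $ (Suc i * n + r)" if i: "i < \<epsilon>" and r: "r < n" for i r
  proof -
    note idx = block_index_less[OF i r]
    have idx': "i * n + r < (\<epsilon> + 1) * n" "Suc i * n + r < (\<epsilon> + 1) * n"
      using i r by (intro block_index_less; simp)+
    \<comment> \<open>The index formula concerns polynomial entries, so \<open>v1\<close> is lifted
      to constants and the product is evaluated at \<open>z\<close>.\<close>
    have "0 = vec_eval (J *\<^sub>v const_vec v1) z $ (i * n + r)"
      unfolding vec_eval_mult[OF J cv1] vec_eval_const bot using idx by simp
    also have "\<dots> = poly ((J *\<^sub>v const_vec v1) $ (i * n + r)) z"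
      using carrier_vecD[OF mult_mat_vec_carrier[OF J cv1]] idx by (intro index_map_vec) (simp only:)
    also have "\<dots> = s * v1 $ (Suc i * n + r) - v1 $ (i * n + r)"
      unfolding J_def L_mult_index[OF cv1 i r] using idx' carrier_vecD[OF v1]
      by (simp del: mult_Suc add_mult_distrib add: s)
    finally show ?thesis by simp
  qed
  have v1_Lambda: "v1 = Lambda_vec \<epsilon> s x"
  proof (rule eq_vec_blocksI[OF v1 Lambda_vec_carrier[OF x]])
    fix i r assume "i < \<epsilon> + 1" and r: "r < n"
    then have i: "i \<le> \<epsilon>" by simp
    \<comment> \<open>Downward induction from the last block, where the exponent is 0.\<close>
    then have "v1 $ (i * n + r) = s ^ (\<epsilon> - i) * v1 $ (\<epsilon> * n + r)"
    proof (induction i rule: inc_induct)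
      case (step i)
      then have "s ^ (\<epsilon> - i) = s * s ^ (\<epsilon> - Suc i)" by (metis Suc_diff_Suc power_Suc)
      with step rec[of i r] r show ?case by simp
    qed simp
    then show "v1 $ (i * n + r) = Lambda_vec \<epsilon> s x $ (i * n + r)"
      using Lambda_vec_index[OF x i r] r by (simp add: x_def)
  qed
  show thesis
  proof (rule that[OF x u])
    show "v = Lambda_vec \<epsilon> s x @\<^sub>v u" using v_eq v1_Lambda by simp
    fix i r assume i: "i \<le> \<eta>" and r: "r < n"
    show "(mat_poly_eval M z *\<^sub>v Lambda_vec \<epsilon> s x) $ (i * n + r)
       = (if i < \<eta> then u $ (i * n + r) else 0) - (if 0 < i then s * u $ ((i - 1) * n + r) else 0)"
    proof -
      have idx: "i * n + r < (\<eta> + 1) * n" using i r by (intro block_index_less) auto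
      have "0 = (mat_poly_eval M z *\<^sub>v v1) $ (i * n + r) + (mat_poly_eval K z *\<^sub>v u) $ (i * n + r)"
        using arg_cong[OF top, of "\<lambda>w. w $ (i * n + r)"] idx carrier_vecD[OF Kv] carrier_vecD[OF Mv]
        by (simp del: index_mult_mat_vec)
      also have "(mat_poly_eval K z *\<^sub>v u) $ (i * n + r) = vec_eval (K *\<^sub>v const_vec u) z $ (i * n + r)"
        unfolding vec_eval_mult[OF K cu] by simp
      also have "\<dots> = poly ((K *\<^sub>v const_vec u) $ (i * n + r)) z"
        using carrier_vecD[OF mult_mat_vec_carrier[OF K cu]] idx by (intro index_map_vec) (simp only:)
      also have "\<dots> = (if 0 < i then s * u $ ((i - 1) * n + r) else 0) - (if i < \<eta> then u $ (i * n + r) else 0)"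
        unfolding K_def transpose_L_mult_index[OF cu i r]
        using carrier_vecD[OF u] block_index_less[of i \<eta> r n] block_index_less[of "i - 1" \<eta> r n] r i
        by (auto simp: s)
      finally show ?thesis unfolding v1_Lambda by (simp add: algebra_simps)
    qed
  qed
qed

section \<open>Norms of null vectors and simple eigenvalues\<close>

text \<open>The recursion is run forwards for $s \le 1$ and backwards for $s > 1$, so that its factor
  never exceeds 1.\<close>

lemma two_sided_recursion_bound:
  fixes a b :: "nat \<Rightarrow> real"
  assumes s: "0 \<le> s" and B: "0 \<le> B" "\<And>k. k \<le> m \<Longrightarrow> b k \<le> B" and a: "\<And>k. 0 \<le> a k"
    and fwd: "\<And>k. k < m \<Longrightarrow> a k \<le> b k + (if 0 < k then s * a (k - 1) else 0)"
    and bwd: "\<And>k. k < m \<Longrightarrow> s * a k \<le> b (Suc k) + (if Suc k < m then a (Suc k) else 0)"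
    and k: "k < m"
  shows "max 1 s * a k \<le> real m * B"
proof (cases "s \<le> 1")
  case True
  have "a k \<le> real (Suc k) * B" if "k < m" for k
    using that
  proof (induction k)
    case 0
    then show ?case using fwd[of 0] B(2)[of 0] by simp
  next
    case (Suc k)
    have "s * a k \<le> a k" using True a[of k] by (simp add: mult_left_le_one_le s)
    with Suc fwd[of "Suc k"] B(2)[of "Suc k"] show ?case by (simp add: algebra_simps)
  qed
  also have "real (Suc k) * B \<le> real m * B" using k B(1) by (intro mult_right_mono) auto
  finally show ?thesis using True k by (simp add: max_def)
next
  case False
  \<comment> \<open>Here \<open>j\<close> counts back from the last index \<open>m - 1\<close>,
    where \<open>bwd\<close> involves only \<open>b m\<close>.\<close>
  have "s * a (m - Suc j) \<le> real (Suc j) * B" if "j < m" for j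
    using that
  proof (induction j)
    case 0
    then show ?case using bwd[of "m - 1"] B(2)[of m] by simp
  next
    case (Suc j)
    \<comment> \<open>As \<open>s\<close> exceeds 1, the induction bound for the product with
      \<open>s\<close> also bounds the term itself, which is what \<open>bwd\<close> asks
      for.\<close>
    have "a (m - Suc j) \<le> s * a (m - Suc j)" using False mult_right_mono[OF _ a[of "m - Suc j"], of 1 s] by simp
    moreover have "Suc (m - Suc (Suc j)) = m - Suc j" using Suc.prems by simp
    ultimately show ?case
      using Suc bwd[of "m - Suc (Suc j)"] B(2)[of "m - Suc j"] by (simp add: algebra_simps)
  qed
  from this[of "m - Suc k"] have "s * a k \<le> real (m - k) * B"
    using k by (simp add: Suc_diff_Suc)
  also have "\<dots> \<le> real m * B" using B(1) by (intro mult_right_mono) auto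
  finally show ?thesis using False by (simp add: max_def)
qed

lemma vec_norm2_append: "(vec_norm2 (u @\<^sub>v v))\<^sup>2 = (vec_norm2 u)\<^sup>2 + (vec_norm2 v)\<^sup>2"
proof -
  have split: "sum f {..<a + b} = sum f {..<a} + (\<Sum>i<b. f (i + a))" for f :: "nat \<Rightarrow> real" and a b
    using sum.atLeastLessThan_concat[of 0 a "a + b" f] sum.shift_bounds_nat_ivl[of f 0 a b]
    by (simp add: lessThan_atLeast0 add.commute)
  show ?thesis by (simp add: vec_norm2_square split)
qed

text \<open>The blocks of \<open>Lambda_vec \<epsilon> s x\<close> have norm at most
  \<open>D\<close>, hence those of its image under \<open>X\<close> at most
  \<open>\<sigma> * E\<close>. The recursion bound carries the factor \<open>\<sigma>\<close> on its
  left side too, so it cancels and each of the \<open>\<eta>\<close> blocks of \<open>u\<close> has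
  norm at most \<open>\<eta>\<close> times \<open>E\<close>.\<close>

lemma kernel_vector_norm_le:
  assumes x: "x \<in> carrier_vec n" and u: "u \<in> carrier_vec (\<eta> * n)"
    and X: "X \<in> carrier_mat ((\<eta> + 1) * n) ((\<epsilon> + 1) * n)"
    and rec: "\<And>i r. i \<le> \<eta> \<Longrightarrow> r < n \<Longrightarrow> (X *\<^sub>v Lambda_vec \<epsilon> s x) $ (i * n + r)
       = (if i < \<eta> then u $ (i * n + r) else 0) - (if 0 < i then s * u $ ((i - 1) * n + r) else 0)"
    and blocks: "\<And>p q w. p \<le> \<eta> \<Longrightarrow> q \<le> \<epsilon> \<Longrightarrow> w \<in> carrier_vec n \<Longrightarrow>
      vec_norm2 (mat_block n X p q *\<^sub>v w) \<le> C * \<sigma> * vec_norm2 w"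
    and C: "1 \<le> C" and \<sigma>: "\<sigma> = max 1 (cmod s)"
  shows "vec_norm2 (Lambda_vec \<epsilon> s x @\<^sub>v u)
    \<le> real (\<eta> + 1) powr (3/2) * (C * real (\<epsilon> + 1) * \<sigma> ^ \<epsilon> * vec_norm2 x)"
proof -
  define D where "D = \<sigma> ^ \<epsilon> * vec_norm2 x"
  define E where "E = C * real (\<epsilon> + 1) * D"
  have \<sigma>1: "1 \<le> \<sigma>" by (simp add: \<sigma>)
  have D0: "0 \<le> D" using \<sigma>1 by (simp add: D_def)
  have E0: "0 \<le> E" using C D0 by (simp add: E_def)
  have \<Lambda>: "vec_norm2 (vec_block n (Lambda_vec \<epsilon> s x) q) \<le> D" if q: "q < \<epsilon> + 1" for q
  proof -
    have "vec_block n (Lambda_vec \<epsilon> s x) q = s ^ (\<epsilon> - q) \<cdot>\<^sub>v x"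
      using x q by (intro eq_vecI) (auto simp: Lambda_vec_index)
    then have "vec_norm2 (vec_block n (Lambda_vec \<epsilon> s x) q) = cmod s ^ (\<epsilon> - q) * vec_norm2 x"
      by (simp add: norm_power)
    also have "cmod s ^ (\<epsilon> - q) \<le> \<sigma> ^ (\<epsilon> - q)" by (intro power_mono) (auto simp: \<sigma>)
    also have "\<sigma> ^ (\<epsilon> - q) \<le> \<sigma> ^ \<epsilon>" using \<sigma>1 by (intro power_increasing) auto
    finally show ?thesis by (simp add: D_def mult_right_mono)
  qed
  define U where "U = vec_block n (X *\<^sub>v Lambda_vec \<epsilon> s x)"
  define \<beta> where "\<beta> = vec_block n u"
  have U: "vec_norm2 (U k) \<le> \<sigma> * E" if k: "k \<le> \<eta>" for k
  proof -
    have "vec_norm2 (U k) \<le> C * \<sigma> * (\<Sum>q<\<epsilon> + 1. vec_norm2 (vec_block n (Lambda_vec \<epsilon> s x) q))"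
      unfolding U_def using k blocks
      by (intro vec_norm2_block_mult_le[OF X Lambda_vec_carrier[OF x]]) auto
    also have "\<dots> \<le> C * \<sigma> * (\<Sum>q<\<epsilon> + 1. D)"
      using C \<sigma>1 \<Lambda> by (intro mult_left_mono sum_mono) auto
    finally show ?thesis by (simp add: E_def ac_simps)
  qed
  have fwd: "vec_norm2 (\<beta> k) \<le> vec_norm2 (U k) + (if 0 < k then cmod s * vec_norm2 (\<beta> (k - 1)) else 0)"
    if k: "k < \<eta>" for k
  proof (cases "0 < k")
    case True
    then have "\<beta> k = U k + s \<cdot>\<^sub>v \<beta> (k - 1)"
      unfolding U_def \<beta>_def using k rec[of k] by (intro eq_vecI) auto
    then show ?thesis
      using vec_norm2_triangle[of "U k" n "s \<cdot>\<^sub>v \<beta> (k - 1)"] True by (simp add: U_def \<beta>_def)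
  next
    case False
    then have "\<beta> k = U k"
      unfolding U_def \<beta>_def using k rec[of k] by (intro eq_vecI) auto
    then show ?thesis using False by simp
  qed
  have bwd: "cmod s * vec_norm2 (\<beta> k) \<le> vec_norm2 (U (Suc k)) + (if Suc k < \<eta> then vec_norm2 (\<beta> (Suc k)) else 0)"
    if k: "k < \<eta>" for k
  proof (cases "Suc k < \<eta>")
    case True
    \<comment> \<open>Row \<open>Suc k\<close> of the recursion, solved for the earlier block. In
      the other case that row is the last one and has no block
      \<open>\<beta> (Suc k)\<close>.\<close>
    then have "s \<cdot>\<^sub>v \<beta> k = (-1) \<cdot>\<^sub>v U (Suc k) + \<beta> (Suc k)"
      unfolding U_def \<beta>_def using k rec[of "Suc k"] by (intro eq_vecI) auto
    then have "cmod s * vec_norm2 (\<beta> k) = vec_norm2 ((-1) \<cdot>\<^sub>v U (Suc k) + \<beta> (Suc k))"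
      by (metis vec_norm2_smult)
    then show ?thesis
      using vec_norm2_triangle[of "(-1) \<cdot>\<^sub>v U (Suc k)" n "\<beta> (Suc k)"] True by (simp add: U_def \<beta>_def)
  next
    case False
    then have "s \<cdot>\<^sub>v \<beta> k = (-1) \<cdot>\<^sub>v U (Suc k)"
      unfolding U_def \<beta>_def using k rec[of "Suc k"] by (intro eq_vecI) auto
    then have "cmod s * vec_norm2 (\<beta> k) = vec_norm2 ((-1) \<cdot>\<^sub>v U (Suc k))"
      by (metis vec_norm2_smult)
    then show ?thesis using False by simp
  qed
  have \<beta>: "vec_norm2 (\<beta> k) \<le> real \<eta> * E" if k: "k < \<eta>" for k
  proof -
    \<comment> \<open>The factor \<open>max 1 s\<close> of \<open>two_sided_recursion_bound\<close>
      is \<open>\<sigma>\<close>, and it cancels the one in the bound for \<open>U\<close>.\<close>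
    have "\<sigma> * vec_norm2 (\<beta> k) \<le> real \<eta> * (\<sigma> * E)"
      unfolding \<sigma> by (rule two_sided_recursion_bound[where b = "\<lambda>k. vec_norm2 (U k)"])
        (use U fwd bwd k \<sigma>1 E0 in \<open>auto simp: \<sigma>\<close>)
    then show ?thesis using \<sigma>1 by (simp add: mult.left_commute)
  qed
  have "(vec_norm2 (Lambda_vec \<epsilon> s x))\<^sup>2 \<le> (\<Sum>q<\<epsilon> + 1. D\<^sup>2)"
    unfolding vec_norm2_blocks[OF Lambda_vec_carrier[OF x]]
    using \<Lambda> by (intro sum_mono power_mono) auto
  also have "\<dots> = real (\<epsilon> + 1) * D\<^sup>2" by simp
  \<comment> \<open>Enlarging here and by the square of \<open>C\<close> below makes
    \<open>E\<close> the common unit for both parts of the vector.\<close>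
  also have "\<dots> \<le> (real (\<epsilon> + 1))\<^sup>2 * D\<^sup>2"
    by (intro mult_right_mono) (auto simp: power2_eq_square)
  also have "\<dots> \<le> C\<^sup>2 * ((real (\<epsilon> + 1))\<^sup>2 * D\<^sup>2)"
    using mult_right_mono[OF one_le_power[OF C, of 2], of "(real (\<epsilon> + 1))\<^sup>2 * D\<^sup>2"] by simp
  also have "\<dots> = E\<^sup>2" by (simp add: E_def power_mult_distrib)
  finally have 1: "(vec_norm2 (Lambda_vec \<epsilon> s x))\<^sup>2 \<le> E\<^sup>2" .
  have "(vec_norm2 u)\<^sup>2 \<le> (\<Sum>k<\<eta>. (real \<eta> * E)\<^sup>2)"
    unfolding vec_norm2_blocks[OF u] using \<beta> by (intro sum_mono power_mono) (auto simp: \<beta>_def)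
  also have "\<dots> = real \<eta> ^ 3 * E\<^sup>2" by (simp add: power2_eq_square power3_eq_cube)
  finally have "(vec_norm2 (Lambda_vec \<epsilon> s x @\<^sub>v u))\<^sup>2 \<le> (1 + real \<eta> ^ 3) * E\<^sup>2"
    using 1 by (simp add: vec_norm2_append algebra_simps)
  \<comment> \<open>The 1 comes from the first part of the vector and the cube from
    \<open>\<eta>\<close> blocks with squared factor \<open>\<eta>\<close>; the root of the cube is
    the exponent 3/2.\<close>
  also have "1 + real \<eta> ^ 3 \<le> real (\<eta> + 1) ^ 3"
    by (simp add: power3_eq_cube algebra_simps)
  also have "real (\<eta> + 1) ^ 3 = (real (\<eta> + 1) powr (3/2))\<^sup>2"
    by (simp add: powr_powr flip: powr_numeral)
  finally have "(vec_norm2 (Lambda_vec \<epsilon> s x @\<^sub>v u))\<^sup>2 \<le> (real (\<eta> + 1) powr (3/2) * E)\<^sup>2"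
    by (simp add: mult_right_mono power_mult_distrib)
  then have "vec_norm2 (Lambda_vec \<epsilon> s x @\<^sub>v u) \<le> real (\<eta> + 1) powr (3/2) * E"
    by (rule power2_le_imp_le) (use E0 in auto)
  then show ?thesis by (simp add: E_def D_def mult.assoc)
qed

section \<open>Block norms of an evaluated matrix polynomial\<close>

lemma poly_eq_sum_coeff:
  fixes p :: "'a::comm_semiring_1 poly"
  assumes "\<And>i. i > l \<Longrightarrow> coeff p i = 0"
  shows "poly p z = (\<Sum>t\<le>l. coeff p t * z ^ t)"
proof -
  have "degree p \<le> l" using assms by (intro degree_le) auto
  then have "(\<Sum>t\<le>degree p. coeff p t * z ^ t) = (\<Sum>t\<le>l. coeff p t * z ^ t)"
    by (intro sum.mono_neutral_left) (auto simp: coeff_eq_0)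
  then show ?thesis by (simp add: poly_altdef)
qed

text \<open>A block of the value at \<open>z\<close> is the sum of \<open>l + 1\<close> coefficient
  blocks with weights \<open>z ^ t\<close>, and each weight is at most the \<open>l\<close>-th power
  of max(1, |z|) in modulus.\<close>

lemma mat_poly_eval_block_norm_le:
  assumes M: "M \<in> carrier_mat (a * n) (b * n)" and grade: "mat_poly_has_grade M l"
    and p: "p < a" and q: "q < b" and w: "w \<in> carrier_vec n"
    and blocks: "\<And>t. t \<le> l \<Longrightarrow> vec_norm2 (mat_block n (mat_poly_coeff M t) p q *\<^sub>v w) \<le> m * vec_norm2 w"
    and m: "0 \<le> m"
  shows "vec_norm2 (mat_block n (mat_poly_eval M z) p q *\<^sub>v w)
    \<le> real (l + 1) * m * max 1 (cmod z) ^ l * vec_norm2 w"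
proof -
  have coeff0: "coeff (M $$ (i, j)) t = 0" if "i < a * n" "j < b * n" "l < t" for i j t
  proof -
    have "mat_poly_coeff M t = 0\<^sub>m (a * n) (b * n)"
      using grade that M by (simp add: mat_poly_has_grade_def)
    then have "mat_poly_coeff M t $$ (i, j) = 0" using that by simp
    then show ?thesis using that M by (simp add: mat_poly_coeff_def)
  qed
  have "(mat_block n (mat_poly_eval M z) p q *\<^sub>v w) $ r
      = (\<Sum>t\<le>l. (z ^ t \<cdot>\<^sub>v (mat_block n (mat_poly_coeff M t) p q *\<^sub>v w)) $ r)" if r: "r < n" for r
  proof -
    have "(mat_block n (mat_poly_eval M z) p q *\<^sub>v w) $ r
        = (\<Sum>s<n. poly (M $$ (p * n + r, q * n + s)) z * w $ s)"
      using r w M block_index_less[OF p r] block_index_less[OF q]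
      by (auto simp: mult_mat_vec_entry[of _ n n] mat_block_def mat_poly_eval_def simp del: index_mult_mat_vec)
    also have "\<dots> = (\<Sum>s<n. \<Sum>t\<le>l. z ^ t * (coeff (M $$ (p * n + r, q * n + s)) t * w $ s))"
    proof (intro sum.cong refl)
      fix s assume "s \<in> {..<n}"
      then have s: "s < n" by simp
      have "poly (M $$ (p * n + r, q * n + s)) z = (\<Sum>t\<le>l. coeff (M $$ (p * n + r, q * n + s)) t * z ^ t)"
        by (intro poly_eq_sum_coeff coeff0 block_index_less p q r s)
      then show "poly (M $$ (p * n + r, q * n + s)) z * w $ s
          = (\<Sum>t\<le>l. z ^ t * (coeff (M $$ (p * n + r, q * n + s)) t * w $ s))"
        by (simp add: sum_distrib_left mult.commute mult.left_commute)
    qed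
    also have "\<dots> = (\<Sum>t\<le>l. z ^ t * (\<Sum>s<n. coeff (M $$ (p * n + r, q * n + s)) t * w $ s))"
      by (subst sum.swap) (simp add: sum_distrib_left)
    also have "\<dots> = (\<Sum>t\<le>l. (z ^ t \<cdot>\<^sub>v (mat_block n (mat_poly_coeff M t) p q *\<^sub>v w)) $ r)"
      using r w M block_index_less[OF p r] block_index_less[OF q]
      by (intro sum.cong) (auto simp: mult_mat_vec_entry[of _ n n] mat_block_def mat_poly_coeff_def simp del: index_mult_mat_vec)
    finally show ?thesis .
  qed
  then have "mat_block n (mat_poly_eval M z) p q *\<^sub>v w
      = vec n (\<lambda>r. \<Sum>t\<le>l. (z ^ t \<cdot>\<^sub>v (mat_block n (mat_poly_coeff M t) p q *\<^sub>v w)) $ r)"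
    by (intro eq_vecI) (auto simp: mat_block_def)
  also have "vec_norm2 \<dots> \<le> (\<Sum>t\<le>l. vec_norm2 (z ^ t \<cdot>\<^sub>v (mat_block n (mat_poly_coeff M t) p q *\<^sub>v w)))"
    using w by (intro vec_norm2_sum) (auto intro: mult_mat_vec_carrier[OF mat_block_carrier])
  also have "\<dots> \<le> (\<Sum>t\<le>l. max 1 (cmod z) ^ l * (m * vec_norm2 w))"
  proof (rule sum_mono)
    fix t assume "t \<in> {..l}"
    then have t: "t \<le> l" by simp
    have "cmod z ^ t \<le> max 1 (cmod z) ^ t" by (intro power_mono) auto
    also have "\<dots> \<le> max 1 (cmod z) ^ l" using t by (intro power_increasing) auto
    finally show "vec_norm2 (z ^ t \<cdot>\<^sub>v (mat_block n (mat_poly_coeff M t) p q *\<^sub>v w))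
        \<le> max 1 (cmod z) ^ l * (m * vec_norm2 w)"
      using blocks[OF t] by (simp add: norm_power mult_mono)
  qed
  also have "\<dots> = real (l + 1) * m * max 1 (cmod z) ^ l * vec_norm2 w" by simp
  finally show ?thesis .
qed

text \<open>Every product in the Leibniz expansion takes one factor from each column, hence contains
  \<open>p\<close> twice.\<close>

lemma det_two_cols_dvd:
  assumes A: "A \<in> carrier_mat n n" and ij: "i < n" "j < n" "i \<noteq> j"
    and dvd: "\<And>r. r < n \<Longrightarrow> p dvd A $$ (r, i)" "\<And>r. r < n \<Longrightarrow> p dvd A $$ (r, j)"
  shows "p ^ 2 dvd Determinant.det A"
  unfolding det_col[OF A]
proof (intro dvd_sum dvd_mult)
  fix \<pi> assume "\<pi> \<in> {\<pi>. \<pi> permutes {0..<n}}"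
  then have \<pi>: "\<pi> k < n" if "k < n" for k using that permutes_in_image[of \<pi> "{0..<n}" k] by simp
  have "(\<Prod>k<n. A $$ (\<pi> k, k))
      = A $$ (\<pi> i, i) * A $$ (\<pi> j, j) * (\<Prod>k\<in>{..<n} - {i} - {j}. A $$ (\<pi> k, k))"
    using ij by (simp add: mult.assoc prod.remove[of "{..<n}" i] prod.remove[of "{..<n} - {i}" j])
  then show "p ^ 2 dvd (\<Prod>k<n. A $$ (\<pi> k, k))"
    unfolding power2_eq_square using dvd \<pi> ij by (simp only:) (intro dvd_mult2 mult_dvd_mono, auto)
qed

lemma simple_eigenvalue_kernel:
  fixes z :: complex
  assumes P: "P \<in> carrier_mat n n" and simple: "order z (Determinant.det P) = 1" "Determinant.det P \<noteq> 0"
    and x: "x \<in> carrier_vec n" "x \<noteq> 0\<^sub>v n" "mat_poly_eval P z *\<^sub>v x = 0\<^sub>v n"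
    and x': "x' \<in> carrier_vec n" "mat_poly_eval P z *\<^sub>v x' = 0\<^sub>v n"
  shows "\<exists>c. x' = c \<cdot>\<^sub>v x"
proof (rule ccontr)
  assume no: "\<nexists>c. x' = c \<cdot>\<^sub>v x"
  obtain i where i: "i < n" "x $ i \<noteq> 0"
    using x(1,2) by (metis eq_vecI carrier_vecD index_zero_vec(1) zero_carrier_vec)
  \<comment> \<open>Two independent null vectors, put by Cramer's lemma into two columns of \<open>P\<close>, make
    both columns divisible by the linear factor at \<open>z\<close>.\<close>
  define c where "c = x' $ i / x $ i"
  define y where "y = x' - c \<cdot>\<^sub>v x"
  have y: "y \<in> carrier_vec n" using x x' by (simp add: y_def)
  have yi: "y $ i = 0" using i x x' by (simp add: y_def c_def)
  have "y \<noteq> 0\<^sub>v n"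
  proof
    assume "y = 0\<^sub>v n"
    then have "x' = c \<cdot>\<^sub>v x"
      using x(1) x'(1) unfolding y_def vec_eq_iff by auto
    with no show False by blast
  qed
  then obtain j where j: "j < n" "y $ j \<noteq> 0"
    using y by (metis eq_vecI carrier_vecD index_zero_vec(1) zero_carrier_vec)
  have "i \<noteq> j" using yi j by auto
  have Py: "mat_poly_eval P z *\<^sub>v y = 0\<^sub>v n"
  proof -
    note Pz = mat_poly_eval_carrier[OF P, of z]
    have "mat_poly_eval P z *\<^sub>v y = mat_poly_eval P z *\<^sub>v x' - mat_poly_eval P z *\<^sub>v (c \<cdot>\<^sub>v x)"
      unfolding y_def using x x' by (intro mult_minus_distrib_mat_vec[OF Pz]) auto
    also have "mat_poly_eval P z *\<^sub>v (c \<cdot>\<^sub>v x) = 0\<^sub>v n"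
      unfolding mult_mat_vec[OF Pz x(1)] x(3) by auto
    finally show ?thesis using x' by auto
  qed
  have cx: "const_vec x \<in> carrier_vec n" and cy: "const_vec y \<in> carrier_vec n" using x y by auto
  have dvd: "[:- z, 1:] dvd (P *\<^sub>v const_vec u) $ r"
    if u: "u \<in> carrier_vec n" "mat_poly_eval P z *\<^sub>v u = 0\<^sub>v n" and r: "r < n" for u r
  proof -
    have cu: "const_vec u \<in> carrier_vec n" using u by auto
    have "poly ((P *\<^sub>v const_vec u) $ r) z = vec_eval (P *\<^sub>v const_vec u) z $ r"
      using P r by simp
    also have "\<dots> = 0" unfolding vec_eval_mult[OF P cu] using u r by simp
    finally show ?thesis by (simp add: poly_eq_0_iff_dvd)
  qed
  define Q where "Q = replace_col P (P *\<^sub>v const_vec x) i"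
  have Q: "Q \<in> carrier_mat n n" using P by (simp add: Q_def replace_col_def)
  have detQ: "Determinant.det Q = [:x $ i:] * Determinant.det P"
    unfolding Q_def using cramer_lemma_mat[OF P cx i(1)] x i by simp
  \<comment> \<open>Column \<open>i\<close> meets the entry \<open>y $ i\<close>, which is 0 by the
    choice of \<open>c\<close>; so replacing it leaves the product unchanged and Cramer's lemma can
    be applied a second time.\<close>
  have Qy: "Q *\<^sub>v const_vec y = P *\<^sub>v const_vec y"
  proof (rule eq_vecI)
    fix r assume "r < dim_vec (P *\<^sub>v const_vec y)"
    then have r: "r < n" using P by simp
    show "(Q *\<^sub>v const_vec y) $ r = (P *\<^sub>v const_vec y) $ r"
      using r P Q y yi by (auto simp: scalar_prod_def Q_def replace_col_def intro!: sum.cong)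
  qed (use P Q in auto)
  define R where "R = replace_col Q (P *\<^sub>v const_vec y) j"
  have R: "R \<in> carrier_mat n n" using Q by (simp add: R_def replace_col_def)
  have "Determinant.det R = [:y $ j:] * Determinant.det Q"
    unfolding R_def Qy[symmetric] using cramer_lemma_mat[OF Q cy j(1)] y j by simp
  then have detR: "Determinant.det R = [:y $ j:] * ([:x $ i:] * Determinant.det P)"
    unfolding detQ .
  have "[:- z, 1:] ^ 2 dvd Determinant.det R"
    using \<open>i \<noteq> j\<close> i(1) j(1) P Q dvd[OF x(1,3)] dvd[OF y Py]
    by (intro det_two_cols_dvd[OF R i(1) j(1)]) (auto simp: R_def Q_def replace_col_def)
  \<comment> \<open>The scalars \<open>x $ i\<close> and \<open>y $ j\<close> are nonzero, so the
    squared factor passes to the determinant of \<open>P\<close>, against order 1.\<close>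
  then have "[:- z, 1:] ^ 2 dvd Determinant.det P"
    unfolding detR using i j by (simp add: dvd_smult_iff)
  then show False using simple by (simp add: order_divides)
qed

section \<open>Coefficient norms and condition numbers\<close>

lemma smult_one_mult_vec:
  "w \<in> carrier_vec n \<Longrightarrow> (c \<cdot>\<^sub>m 1\<^sub>m n) *\<^sub>v w = c \<cdot>\<^sub>v (w :: 'a::comm_ring_1 Matrix.vec)"
  by (rule eq_vecI) auto

lemma kronecker_pencil_carrier':
  assumes "M \<in> carrier_mat ((\<eta> + 1) * n) ((\<epsilon> + 1) * n)"
  shows "kronecker_pencil \<epsilon> n \<eta> q M \<in> carrier_mat ((\<epsilon> + \<eta> + 1) * n) ((\<epsilon> + \<eta> + 1) * n)"
  using kronecker_pencil_carrier[OF assms, of q] by (simp add: algebra_simps)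

text \<open>Outside the corner \<open>M\<close> a block is an entry of an L-matrix times the
  identity, or zero. Those entries are 0, -1 or a monic monomial, so their coefficients have modulus
  at most 1.\<close>

lemma kronecker_pencil_coeff_block:
  assumes M: "M \<in> carrier_mat ((\<eta> + 1) * n) ((\<epsilon> + 1) * n)"
    and p: "p < \<epsilon> + \<eta> + 1" and p': "p' < \<epsilon> + \<eta> + 1"
  shows "p \<le> \<eta> \<and> p' \<le> \<epsilon> \<and>
      mat_block n (mat_poly_coeff (kronecker_pencil \<epsilon> n \<eta> (monom 1 l) M) i) p p'
        = mat_block n (mat_poly_coeff M i) p p' \<or>
    (\<exists>c. cmod c \<le> 1 \<and>
      mat_block n (mat_poly_coeff (kronecker_pencil \<epsilon> n \<eta> (monom 1 l) M) i) p p' = c \<cdot>\<^sub>m 1\<^sub>m n)"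
proof -
  let ?q = "monom 1 l :: complex poly"
  define K where "K = kronecker (transpose_mat (L_mat \<eta> ?q)) (1\<^sub>m n)"
  define J where "J = kronecker (L_mat \<epsilon> ?q) (1\<^sub>m n)"
  define A where "A = kronecker_pencil \<epsilon> n \<eta> ?q M"
  have A_def': "A = four_block_mat M K J (0\<^sub>m (\<epsilon> * n) (\<eta> * n))"
    by (simp add: A_def kronecker_pencil_def K_def J_def)
  note A = kronecker_pencil_carrier'[OF M, of ?q, folded A_def]
  have L_coeff: "cmod (coeff (L_mat k ?q $$ (a, b)) i) \<le> 1" if "a < k" "b \<le> k" for k a b
    using that by (auto simp: L_mat_def coeff_monom)
  have T: "transpose_mat (L_mat \<eta> ?q) \<in> carrier_mat (\<eta> + 1) \<eta>"
    using L_mat_carrier by simp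
  note dims = carrier_matD[OF M] carrier_matD[OF kronecker_L_carriers(2)[of \<eta> ?q n, folded K_def]]
    carrier_matD[OF kronecker_L_carriers(1)[of \<epsilon> ?q n, folded J_def]]
  have entry: "A $$ (p * n + r, p' * n + r') =
      (if p \<le> \<eta> then if p' \<le> \<epsilon> then M $$ (p * n + r, p' * n + r')
         else K $$ (p * n + r, (p' - (\<epsilon> + 1)) * n + r')
       else if p' \<le> \<epsilon> then J $$ ((p - (\<eta> + 1)) * n + r, p' * n + r') else 0)"
    if r: "r < n" and r': "r' < n" for r r'
  proof -
    \<comment> \<open>Stated for arbitrary indices, because it is used for the row split and for the
      column split.\<close>
    have top: "p * n + r < (\<eta> + 1) * n \<longleftrightarrow> p \<le> \<eta>" if r: "r < n" for p \<eta> r :: nat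
    proof
      assume "p \<le> \<eta>"
      then show "p * n + r < (\<eta> + 1) * n" using r by (intro block_index_less) auto
    next
      assume "p * n + r < (\<eta> + 1) * n"
      from block_index_div_mod(1)[OF this] show "p \<le> \<eta>" using r by simp
    qed
    have diff: "p * n + r - (\<eta> + 1) * n = (p - (\<eta> + 1)) * n + r" if "\<not> p \<le> \<eta>" for p \<eta> r :: nat
    proof -
      have "(\<eta> + 1) * n \<le> p * n" using that by (intro mult_le_mono1) simp
      then show ?thesis by (simp only: diff_mult_distrib)
    qed
    have less: "p * n + r < (\<epsilon> + \<eta> + 1) * n" "p' * n + r' < (\<epsilon> + \<eta> + 1) * n"
      using p p' r r' by (intro block_index_less; simp)+
    have idx0: "(p - (\<eta> + 1)) * n + r < \<epsilon> * n" if "\<not> p \<le> \<eta>"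
      using that p r by (intro block_index_less) auto
    have idx0': "(p' - (\<epsilon> + 1)) * n + r' < \<eta> * n" if "\<not> p' \<le> \<epsilon>"
      using that p' r' by (intro block_index_less) auto
    have "A $$ (p * n + r, p' * n + r') =
      (if p * n + r < (\<eta> + 1) * n then if p' * n + r' < (\<epsilon> + 1) * n then M $$ (p * n + r, p' * n + r')
         else K $$ (p * n + r, p' * n + r' - (\<epsilon> + 1) * n)
       else if p' * n + r' < (\<epsilon> + 1) * n then J $$ (p * n + r - (\<eta> + 1) * n, p' * n + r')
       else 0\<^sub>m (\<epsilon> * n) (\<eta> * n) $$ (p * n + r - (\<eta> + 1) * n, p' * n + r' - (\<epsilon> + 1) * n))"
      unfolding A_def' using less dims
      by (subst index_mat_four_block(1)) (simp_all add: algebra_simps)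
    then show ?thesis
      using top[OF r] top[OF r'] diff idx0 idx0' by (simp del: add_mult_distrib mult_Suc)
  qed
  have block: "mat_block n (mat_poly_coeff A i) p p' $$ (r, r') = coeff (A $$ (p * n + r, p' * n + r')) i"
    if "r < n" "r' < n" for r r'
    using that p p' A block_index_less[of p "\<epsilon> + \<eta> + 1" r n] block_index_less[of p' "\<epsilon> + \<eta> + 1" r' n]
    by (auto simp: mat_block_def mat_poly_coeff_def)
  show ?thesis unfolding A_def[symmetric]
  proof (cases "p \<le> \<eta> \<and> p' \<le> \<epsilon>")
    case True
    have "mat_block n (mat_poly_coeff A i) p p' = mat_block n (mat_poly_coeff M i) p p'"
    proof (rule eq_matI)
      fix r r' assume "r < dim_row (mat_block n (mat_poly_coeff M i) p p')"
        "r' < dim_col (mat_block n (mat_poly_coeff M i) p p')"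
      then have r: "r < n" "r' < n" by (auto simp: mat_block_def)
      show "mat_block n (mat_poly_coeff A i) p p' $$ (r, r') = mat_block n (mat_poly_coeff M i) p p' $$ (r, r')"
        unfolding block[OF r] entry[OF r]
        using True r M block_index_less[of p "\<eta> + 1" r n] block_index_less[of p' "\<epsilon> + 1" r' n]
        by (simp add: mat_block_def mat_poly_coeff_def)
    qed (auto simp: mat_block_def)
    with True show "p \<le> \<eta> \<and> p' \<le> \<epsilon> \<and>
        mat_block n (mat_poly_coeff A i) p p' = mat_block n (mat_poly_coeff M i) p p' \<or>
      (\<exists>c. cmod c \<le> 1 \<and> mat_block n (mat_poly_coeff A i) p p' = c \<cdot>\<^sub>m 1\<^sub>m n)" by blast
  next
    case False
    \<comment> \<open>The indices into \<open>L_mat \<eta>\<close> are swapped because the upper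
      right corner contains its transpose.\<close>
    define c where "c = (if p \<le> \<eta> then coeff (L_mat \<eta> ?q $$ (p' - (\<epsilon> + 1), p)) i
      else if p' \<le> \<epsilon> then coeff (L_mat \<epsilon> ?q $$ (p - (\<eta> + 1), p')) i else 0)"
    have "cmod c \<le> 1" using False p p' L_coeff by (auto simp: c_def)
    moreover have "mat_block n (mat_poly_coeff A i) p p' = c \<cdot>\<^sub>m 1\<^sub>m n"
    proof (rule eq_matI)
      fix r r' assume "r < dim_row (c \<cdot>\<^sub>m 1\<^sub>m n)" "r' < dim_col (c \<cdot>\<^sub>m 1\<^sub>m n)"
      then have r: "r < n" "r' < n" by auto
      show "mat_block n (mat_poly_coeff A i) p p' $$ (r, r') = (c \<cdot>\<^sub>m 1\<^sub>m n) $$ (r, r')"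
        unfolding block[OF r] entry[OF r] K_def J_def
        using False p p' r L_mat_carrier[of \<eta> ?q]
        by (auto simp: c_def kronecker_one_index[OF T] kronecker_one_index[OF L_mat_carrier])
    qed (auto simp: mat_block_def)
    ultimately show "p \<le> \<eta> \<and> p' \<le> \<epsilon> \<and>
        mat_block n (mat_poly_coeff A i) p p' = mat_block n (mat_poly_coeff M i) p p' \<or>
      (\<exists>c. cmod c \<le> 1 \<and> mat_block n (mat_poly_coeff A i) p p' = c \<cdot>\<^sub>m 1\<^sub>m n)" by blast
  qed
qed

text \<open>As \<open>m\<close> is at least 1, it bounds the scalar blocks as well as those of
  \<open>M\<close>, so one bound serves the whole block partition.\<close>

lemma kronecker_pencil_coeff_norm_le:
  assumes M: "M \<in> carrier_mat ((\<eta> + 1) * n) ((\<epsilon> + 1) * n)"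
    and blocks: "\<And>p q w. p \<le> \<eta> \<Longrightarrow> q \<le> \<epsilon> \<Longrightarrow> w \<in> carrier_vec n \<Longrightarrow>
      vec_norm2 (mat_block n (mat_poly_coeff M i) p q *\<^sub>v w) \<le> m * vec_norm2 w"
    and m: "1 \<le> m"
  shows "spectral_norm (mat_poly_coeff (kronecker_pencil \<epsilon> n \<eta> (monom 1 l) M) i) \<le> m * real (\<epsilon> + \<eta> + 1)"
proof (rule spectral_norm_block_le[OF mat_poly_coeff_carrier[OF kronecker_pencil_carrier'[OF M]]])
  fix p q and w :: "complex Matrix.vec"
  assume "p < \<epsilon> + \<eta> + 1" "q < \<epsilon> + \<eta> + 1" and w: "w \<in> carrier_vec n"
  from kronecker_pencil_coeff_block[OF M this(1,2), of l i]
  show "vec_norm2 (mat_block n (mat_poly_coeff (kronecker_pencil \<epsilon> n \<eta> (monom 1 l) M) i) p q *\<^sub>v w)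
      \<le> m * vec_norm2 w"
  proof
    assume "\<exists>c. cmod c \<le> 1 \<and>
      mat_block n (mat_poly_coeff (kronecker_pencil \<epsilon> n \<eta> (monom 1 l) M) i) p q = c \<cdot>\<^sub>m 1\<^sub>m n"
    then obtain c where "cmod c \<le> 1"
      "mat_block n (mat_poly_coeff (kronecker_pencil \<epsilon> n \<eta> (monom 1 l) M) i) p q = c \<cdot>\<^sub>m 1\<^sub>m n"
      by blast
    then show ?thesis using m w by (simp add: smult_one_mult_vec mult_right_mono)
  qed (use blocks w in auto)
qed (use m in simp)

section \<open>Powers of max(1, |z|) and lower bounds for the coefficient sums of
  \<open>P\<close>\<close>

lemma max_one_power: "0 \<le> (r::real) \<Longrightarrow> max 1 (r ^ k) = max 1 r ^ k"
  by (cases "r \<le> 1") (simp_all add: max_absorb1 max_absorb2 power_le_one one_le_power)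

text \<open>One term is enough: the first if \<open>r\<close> is at most 1, the last otherwise. This
  is where the minimum of the norms of the lowest and the highest coefficient arises.\<close>

lemma sum_powers_ge_min:
  fixes f :: "nat \<Rightarrow> real"
  assumes r: "0 \<le> r" and f: "\<And>i. 0 \<le> f i"
  shows "max 1 r ^ d * min (f 0) (f d) \<le> (\<Sum>i=0..d. r ^ i * f i)"
proof (cases "r \<le> 1")
  case True
  have "max 1 r ^ d * min (f 0) (f d) \<le> r ^ 0 * f 0" using True by (simp add: max_def)
  also have "\<dots> \<le> (\<Sum>i=0..d. r ^ i * f i)" using r f by (intro member_le_sum) auto
  finally show ?thesis .
next
  case False
  then have "max 1 r ^ d * min (f 0) (f d) \<le> r ^ d * f d" by (simp add: max_def mult_left_mono)
  also have "\<dots> \<le> (\<Sum>i=0..d. r ^ i * f i)" using r f by (intro member_le_sum) auto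
  finally show ?thesis .
qed

text \<open>Placing \<open>u\<close> in slot \<open>i\<close> and zeros elsewhere preserves the norm
  and reduces the block row to its coefficient \<open>i\<close>.\<close>

lemma spectral_norm_coeff_le_block_row:
  assumes P: "P \<in> carrier_mat n n" and i: "i \<le> d"
  shows "spectral_norm (mat_poly_coeff P i) \<le> spectral_norm (coeff_block_row d P)"
proof (rule spectral_norm_le[OF mat_poly_coeff_carrier[OF P] spectral_norm_nonneg])
  fix u :: "complex Matrix.vec" assume u: "u \<in> carrier_vec n"
  define E where "E = vec ((d + 1) * n) (\<lambda>j. if j div n = i then u $ (j mod n) else 0)"
  have E: "E \<in> carrier_vec ((d + 1) * n)" by (simp add: E_def)
  have E_index: "E $ (k * n + r) = (if k = i then u $ r else 0)" if "k < d + 1" "r < n" for k r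
    using block_index_less[OF that] that by (simp add: E_def)
  have R: "coeff_block_row d P \<in> carrier_mat n ((d + 1) * n)"
    using P by (simp add: coeff_block_row_def)
  have "(vec_norm2 E)\<^sup>2 = (\<Sum>k<d + 1. \<Sum>r<n. (cmod (E $ (k * n + r)))\<^sup>2)"
    unfolding vec_norm2_square carrier_vecD[OF E] by (rule sum_blocks)
  also have "\<dots> = (\<Sum>k<d + 1. if k = i then \<Sum>r<n. (cmod (u $ r))\<^sup>2 else 0)"
    by (intro sum.cong refl) (simp add: E_index)
  also have "\<dots> = (vec_norm2 u)\<^sup>2" using u i by (simp add: vec_norm2_square del: sum.lessThan_Suc)
  finally have norm_E: "vec_norm2 E = vec_norm2 u" by simp
  have "coeff_block_row d P *\<^sub>v E = mat_poly_coeff P i *\<^sub>v u"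
  proof (rule eq_vecI)
    fix r assume "r < dim_vec (mat_poly_coeff P i *\<^sub>v u)"
    then have r: "r < n" using P by (simp add: mat_poly_coeff_def)
    have "(coeff_block_row d P *\<^sub>v E) $ r
        = (\<Sum>k<d + 1. \<Sum>s<n. coeff_block_row d P $$ (r, k * n + s) * E $ (k * n + s))"
      unfolding mult_mat_vec_entry[OF R E r] by (rule sum_blocks)
    also have "\<dots> = (\<Sum>k<d + 1. if k = i then \<Sum>s<n. mat_poly_coeff P i $$ (r, s) * u $ s else 0)"
    proof (intro sum.cong refl)
      fix k assume "k \<in> {..<d + 1}"
      then have k: "k < d + 1" by simp
      show "(\<Sum>s<n. coeff_block_row d P $$ (r, k * n + s) * E $ (k * n + s))
          = (if k = i then \<Sum>s<n. mat_poly_coeff P i $$ (r, s) * u $ s else 0)"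
        using P r k block_index_less[OF k, of _ n] by (auto simp: E_index coeff_block_row_def)
    qed
    also have "\<dots> = (mat_poly_coeff P i *\<^sub>v u) $ r"
      unfolding mult_mat_vec_entry[OF mat_poly_coeff_carrier[OF P] u r]
      using i by (simp del: sum.lessThan_Suc)
    finally show "(coeff_block_row d P *\<^sub>v E) $ r = (mat_poly_coeff P i *\<^sub>v u) $ r" .
  qed (use P R in \<open>auto simp: mat_poly_coeff_def\<close>)
  then show "vec_norm2 (mat_poly_coeff P i *\<^sub>v u) \<le> spectral_norm (coeff_block_row d P) * vec_norm2 u"
    using vec_norm2_mult_le[OF R E] norm_E by simp
qed

text \<open>The final cancellation in real numbers. \<open>T\<close> is the numerator for the
  pencil, \<open>S\<close> the coefficient sum for \<open>P\<close>, \<open>R\<close> the power of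
  max(1, |z|), and \<open>a\<close>, \<open>b\<close> the moduli of the factors relating the null
  vectors to the given eigenvectors.\<close>

lemma condition_ratio_le:
  fixes S T :: real
  assumes T: "T \<le> K * R * (a * x * (b * y))" and S: "R * \<mu> \<le> S"
    and "0 < \<mu>" "0 < R" "0 \<le> K" "0 \<le> a" "0 \<le> b" "0 < x" "0 < y" "0 < c" "0 \<le> D"
  shows "T / (c * (a * b * D)) / (S * x * y / (c * D)) \<le> K / \<mu>"
proof (cases "a * b * D = 0")
  \<comment> \<open>The first quotient then has denominator 0 and value 0, while the right side is
    nonnegative.\<close>
  case True
  then show ?thesis using assms by auto
next
  case False
  then have pos: "0 < a" "0 < b" "0 < D" using assms by auto
  have S0: "0 < S" using S \<open>0 < \<mu>\<close> \<open>0 < R\<close> mult_pos_pos[of R \<mu>] by linarith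
  have "T / (c * (a * b * D)) / (S * x * y / (c * D)) = T / (a * x * (b * y) * S)"
    using pos S0 assms by (simp add: field_simps)
  also have "\<dots> \<le> K * R * (a * x * (b * y)) / (a * x * (b * y) * S)"
    using T pos S0 assms by (intro divide_right_mono) auto
  also have "\<dots> = K * R / S" using pos S0 assms by (simp add: field_simps)
  also have "\<dots> \<le> K * R / (R * \<mu>)"
    using S S0 assms by (intro divide_left_mono) auto
  also have "\<dots> = K / \<mu>" using assms by simp
  finally show ?thesis .
qed

text \<open>With \<open>c\<close> the conjugate of a left eigenvector, this turns it into a column
  null vector of the transpose, not of the adjoint, so the bilinear product can be used
  throughout.\<close>

lemma left_null_vector_transpose:
  fixes A :: "'a::comm_semiring_0 mat"
  assumes A: "A \<in> carrier_mat nr nc" and c: "c \<in> carrier_vec nr"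
    and 0: "mat_of_row c * A = 0\<^sub>m 1 nc"
  shows "transpose_mat A *\<^sub>v c = 0\<^sub>v nc"
proof (rule eq_vecI)
  fix j assume "j < dim_vec (0\<^sub>v nc :: 'a Matrix.vec)"
  then have j: "j < nc" by simp
  have "(mat_of_row c * A) $$ (0, j) = c \<bullet> col A j" using A j by simp
  then have "c \<bullet> col A j = 0" using 0 j by simp
  then show "(transpose_mat A *\<^sub>v c) $ j = 0\<^sub>v nc $ j"
    using A j c comm_scalar_prod[of c nr "col A j"] by auto
qed (use A in simp)

text \<open>Combines the kernel description with the norm bound, for \<open>C\<close> equal to
  \<open>(l + 1) * m\<close> and \<open>\<sigma>\<close> equal to \<open>\<rho> ^ l\<close>. With
  \<open>M\<close> general it serves right null vectors directly and left ones after
  transposition.\<close>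

lemma kronecker_pencil_kernel_bound:
  assumes M: "M \<in> carrier_mat ((\<eta> + 1) * n) ((\<epsilon> + 1) * n)" and grade: "mat_poly_has_grade M l"
    and P: "P = kronecker (transpose_mat (Lambda_mat \<eta> (monom 1 l))) (1\<^sub>m n) * M
      * kronecker (Lambda_mat \<epsilon> (monom 1 l)) (1\<^sub>m n)"
    and P_carrier: "P \<in> carrier_mat n n"
    and blocks: "\<And>t p q w. t \<le> l \<Longrightarrow> p \<le> \<eta> \<Longrightarrow> q \<le> \<epsilon> \<Longrightarrow> w \<in> carrier_vec n \<Longrightarrow>
      vec_norm2 (mat_block n (mat_poly_coeff M t) p q *\<^sub>v w) \<le> m * vec_norm2 w"
    and m: "1 \<le> m" and \<rho>: "\<rho> = max 1 (cmod z)"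
    and v: "v \<in> carrier_vec ((\<epsilon> + 1) * n + \<eta> * n)"
    and kernel: "mat_poly_eval (kronecker_pencil \<epsilon> n \<eta> (monom 1 l) M) z *\<^sub>v v
      = 0\<^sub>v ((\<eta> + 1) * n + \<epsilon> * n)"
  obtains x u where "x \<in> carrier_vec n" "u \<in> carrier_vec (\<eta> * n)"
    "v = Lambda_vec \<epsilon> (poly (monom 1 l) z) x @\<^sub>v u" "mat_poly_eval P z *\<^sub>v x = 0\<^sub>v n"
    "vec_norm2 v \<le> real (\<eta> + 1) powr (3/2)
      * (real (l + 1) * m * real (\<epsilon> + 1) * \<rho> ^ (l * \<epsilon>) * vec_norm2 x)"
proof -
  define s where "s = poly (monom 1 l) z"
  obtain x u where x: "x \<in> carrier_vec n" and u: "u \<in> carrier_vec (\<eta> * n)"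
    and v_eq: "v = Lambda_vec \<epsilon> s x @\<^sub>v u"
    and rec: "\<And>i r. i \<le> \<eta> \<Longrightarrow> r < n \<Longrightarrow> (mat_poly_eval M z *\<^sub>v Lambda_vec \<epsilon> s x) $ (i * n + r)
       = (if i < \<eta> then u $ (i * n + r) else 0) - (if 0 < i then s * u $ ((i - 1) * n + r) else 0)"
    using kronecker_pencil_kernel[OF M s_def v kernel] by blast
  \<comment> \<open>Only the first part of \<open>kronecker_pencil_deriv\<close> is wanted;
    \<open>x\<close> and this zero vector fill the places of the left vector.\<close>
  have t: "0\<^sub>v (\<epsilon> * n) \<in> carrier_vec (\<epsilon> * n)" by simp
  have Px: "mat_poly_eval P z *\<^sub>v x = 0\<^sub>v n"
    by (rule kronecker_pencil_deriv(1)[OF M P P_carrier x x u t s_def kernel[unfolded v_eq]])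
  have \<sigma>: "\<rho> ^ l = max 1 (cmod s)"
    by (simp add: s_def poly_monom norm_power max_one_power \<rho>)
  have C: "1 \<le> real (l + 1) * m" using mult_mono[of 1 "real (l + 1)" 1 m] m by simp
  have "vec_norm2 (Lambda_vec \<epsilon> s x @\<^sub>v u)
      \<le> real (\<eta> + 1) powr (3/2) * (real (l + 1) * m * real (\<epsilon> + 1) * (\<rho> ^ l) ^ \<epsilon> * vec_norm2 x)"
  proof (rule kernel_vector_norm_le[OF x u mat_poly_eval_carrier[OF M] rec _ C \<sigma>])
    fix p q and w :: "complex Matrix.vec"
    assume "p \<le> \<eta>" "q \<le> \<epsilon>" and w: "w \<in> carrier_vec n"
    then have "p < \<eta> + 1" "q < \<epsilon> + 1" by auto
    then show "vec_norm2 (mat_block n (mat_poly_eval M z) p q *\<^sub>v w)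
        \<le> real (l + 1) * m * \<rho> ^ l * vec_norm2 w"
      unfolding \<rho> by (rule mat_poly_eval_block_norm_le[OF M grade _ _ w])
        (use blocks \<open>p \<le> \<eta>\<close> \<open>q \<le> \<epsilon>\<close> w m in auto)
  qed auto
  then have "vec_norm2 v \<le> real (\<eta> + 1) powr (3/2)
      * (real (l + 1) * m * real (\<epsilon> + 1) * \<rho> ^ (l * \<epsilon>) * vec_norm2 x)"
    by (simp add: v_eq power_mult)
  with that x u v_eq Px show thesis by (simp add: s_def)
qed

section \<open>Transposition, which exchanges \<open>\<epsilon>\<close> and
  \<open>\<eta>\<close>\<close>

lemma transpose_kronecker_sandwich:
  fixes M :: "complex poly mat"
  assumes M: "M \<in> carrier_mat ((\<eta> + 1) * n) ((\<epsilon> + 1) * n)"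
  shows "transpose_mat (kronecker (transpose_mat (Lambda_mat \<eta> q)) (1\<^sub>m n) * M * kronecker (Lambda_mat \<epsilon> q) (1\<^sub>m n))
    = kronecker (transpose_mat (Lambda_mat \<epsilon> q)) (1\<^sub>m n) * transpose_mat M * kronecker (Lambda_mat \<eta> q) (1\<^sub>m n)"
proof -
  define A where "A = kronecker (Lambda_mat \<eta> q) (1\<^sub>m n)"
  define B where "B = kronecker (Lambda_mat \<epsilon> q) (1\<^sub>m n)"
  have A: "A \<in> carrier_mat ((\<eta> + 1) * n) n" and B: "B \<in> carrier_mat ((\<epsilon> + 1) * n) n"
    unfolding A_def B_def
    using kronecker_one_carrier[OF Lambda_mat_carrier, of _ _ n] by simp_all
  have At: "transpose_mat A \<in> carrier_mat n ((\<eta> + 1) * n)" using A by simp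
  have Bt: "transpose_mat B \<in> carrier_mat n ((\<epsilon> + 1) * n)" using B by simp
  have Mt: "transpose_mat M \<in> carrier_mat ((\<epsilon> + 1) * n) ((\<eta> + 1) * n)" using M by simp
  have "transpose_mat (transpose_mat A * M * B) = transpose_mat B * (transpose_mat M * A)"
    unfolding transpose_mult[OF mult_carrier_mat[OF At M] B] transpose_mult[OF At M] by simp
  also have "\<dots> = transpose_mat B * transpose_mat M * A"
    by (rule assoc_mult_mat[symmetric, OF Bt Mt A])
  finally show ?thesis
    by (simp add: A_def B_def transpose_kronecker_one)
qed

lemma mat_poly_eval_transpose: "mat_poly_eval (transpose_mat A) z = transpose_mat (mat_poly_eval A z)"
  by (rule eq_matI) (auto simp: mat_poly_eval_def)

lemma mat_poly_coeff_transpose: "mat_poly_coeff (transpose_mat A) i = transpose_mat (mat_poly_coeff A i)"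
  by (rule eq_matI) (auto simp: mat_poly_coeff_def)

lemma mat_poly_has_grade_transpose: "mat_poly_has_grade A l \<Longrightarrow> mat_poly_has_grade (transpose_mat A) l"
  by (simp add: mat_poly_has_grade_def mat_poly_coeff_transpose)

lemma mat_block_transpose:
  assumes A: "A \<in> carrier_mat (a * n) (b * n)" and "p < b" "q < a"
  shows "mat_block n (transpose_mat A) p q = transpose_mat (mat_block n A q p)"
  using A block_index_less[OF \<open>p < b\<close>] block_index_less[OF \<open>q < a\<close>]
  by (intro eq_matI) (auto simp: mat_block_def)

text \<open>Since \<open>l\<close> is at least 1, \<open>l + 1\<close> is at most
  \<open>2 * l\<close>, which yields 8; the product of \<open>\<epsilon> + 1\<close> and
  \<open>\<eta> + 1\<close> supplies two more factors \<open>\<epsilon> + \<eta> + 1\<close> and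
  completes the cube. Of the three factors \<open>l + 1\<close>, one comes from the coefficient sum
  of the pencil and one from each null vector.\<close>

lemma combined_constant_le:
  fixes \<epsilon> \<eta> l :: nat
  assumes "1 \<le> l"
  shows "real (l + 1) ^ 3 * real (\<epsilon> + \<eta> + 1) * (real (\<epsilon> + 1) * real (\<eta> + 1))
    \<le> 16 * real (l * (\<epsilon> + \<eta> + 1)) ^ 3"
proof -
  have "real (l + 1) ^ 3 \<le> (2 * real l) ^ 3" using assms by (intro power_mono) auto
  moreover have "real (\<epsilon> + 1) * real (\<eta> + 1) \<le> real (\<epsilon> + \<eta> + 1) ^ 2"
    by (simp add: power2_eq_square algebra_simps)
  ultimately have "real (l + 1) ^ 3 * (real (\<epsilon> + \<eta> + 1) * (real (\<epsilon> + 1) * real (\<eta> + 1)))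
      \<le> (2 * real l) ^ 3 * (real (\<epsilon> + \<eta> + 1) * real (\<epsilon> + \<eta> + 1) ^ 2)"
    by (intro mult_mono mult_left_mono) auto
  also have "\<dots> = 8 * real (l * (\<epsilon> + \<eta> + 1)) ^ 3"
    unfolding of_nat_mult power_mult_distrib by (simp add: power2_eq_square power3_eq_cube)
  also have "\<dots> \<le> 16 * real (l * (\<epsilon> + \<eta> + 1)) ^ 3" by (intro mult_right_mono) auto
  finally show ?thesis by (simp only: mult.assoc)
qed

theorem theorem5p2:
  fixes P LL :: "complex poly mat" and n d l \<epsilon> \<eta> :: nat and z :: complex
    and x y v w :: "complex Matrix.vec"
  assumes "P \<in> carrier_mat n n"
    and "regular_mat_poly P"
    and "mat_poly_has_degree P d"
    and "l \<ge> 1" and "l dvd d" and "\<epsilon> + \<eta> + 1 = d div l"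
    and "block_kronecker_companion_form \<epsilon> n \<eta> l d P LL"
    and "simple_eigenvalue P z" and "z \<noteq> 0"
    and "right_eigenvector P z x" and "left_eigenvector P z y"
    and "right_eigenvector LL z v" and "left_eigenvector LL z w"
  shows "ereal (coeff_cond l LL z v w / coeff_cond d P z x y) \<le>
           (if mat_poly_coeff P 0 = 0\<^sub>m n n then \<infinity>
            else ereal (16 * real d ^ 3 * real (\<epsilon> + 1) powr (3/2) * real (\<eta> + 1) powr (3/2) *
                   (max 1 (MAX i\<in>{0..d}. spectral_norm (mat_poly_coeff P i) ^ 3) /
                    min (spectral_norm (mat_poly_coeff P 0)) (spectral_norm (mat_poly_coeff P d))))) \<and>
         coeff_cond l LL z v w / norm_cond d P z x y \<le>
           16 * real d ^ 3 * real (\<epsilon> + 1) powr (3/2) * real (\<eta> + 1) powr (3/2) *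
             (max 1 (MAX i\<in>{0..d}. spectral_norm (mat_poly_coeff P i) ^ 3) /
              (MAX i\<in>{0..d}. spectral_norm (mat_poly_coeff P i)))"
proof -
  note P = assms(1)
  obtain M where lif: "block_kronecker_lification \<epsilon> n \<eta> l P M LL"
    and M_blocks: "\<forall>t\<le>l. \<forall>p\<le>\<eta>. \<forall>q\<le>\<epsilon>. mat_block n (mat_poly_coeff M t) p q
      \<in> {0\<^sub>m n n, 1\<^sub>m n} \<union> mat_poly_coeff P ` {0..d}"
    using assms(7) unfolding block_kronecker_companion_form_def by blast
  have M: "M \<in> carrier_mat ((\<eta> + 1) * n) ((\<epsilon> + 1) * n)" and grade: "mat_poly_has_grade M l"
    and P_eq: "P = kronecker (transpose_mat (Lambda_mat \<eta> (monom 1 l))) (1\<^sub>m n) * M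
      * kronecker (Lambda_mat \<epsilon> (monom 1 l)) (1\<^sub>m n)"
    and LL: "LL = kronecker_pencil \<epsilon> n \<eta> (monom 1 l) M"
    using lif unfolding block_kronecker_lification_def kronecker_pencil_def by auto

  \<comment> \<open>Constants and bounds for the blocks of \<open>M\<close>\<close>
  define N where "N = \<epsilon> + \<eta> + 1"
  have d: "d = l * N" using assms(5,6) by (simp add: N_def)
  define f where "f i = spectral_norm (mat_poly_coeff P i)" for i
  define \<mu> where "\<mu> = (MAX i\<in>{0..d}. f i)"
  define m where "m = max 1 \<mu>"
  define \<rho> where "\<rho> = max 1 (cmod z)"
  define s where "s = poly (monom 1 l) z"
  have f_le: "f i \<le> \<mu>" if "i \<le> d" for i using that by (auto simp: \<mu>_def)
  have m1: "1 \<le> m" by (simp add: m_def)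
  have \<rho>1: "1 \<le> \<rho>" by (simp add: \<rho>_def)
  \<comment> \<open>The stated bound has the maximum of cubes, the estimates produce the cube of a
    maximum; the index attaining \<open>\<mu>\<close> links them.\<close>
  have m3: "m ^ 3 \<le> max 1 (MAX i\<in>{0..d}. f i ^ 3)"
  proof -
    have "\<mu> \<in> f ` {0..d}" unfolding \<mu>_def by (rule Max_in) auto
    then obtain i where "i \<in> {0..d}" "\<mu> = f i" by blast
    then have "\<mu> ^ 3 \<le> (MAX i\<in>{0..d}. f i ^ 3)" and "0 \<le> \<mu>" by (auto simp: f_def)
    then show ?thesis using max_one_power[of \<mu> 3] by (auto simp: m_def)
  qed
  \<comment> \<open>Here the restriction of the blocks to 0, the identity and coefficients of
    \<open>P\<close> enters: \<open>m\<close> is at least 1 and at least every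
    \<open>f i\<close>.\<close>
  have M_bound: "vec_norm2 (mat_block n (mat_poly_coeff M t) p q *\<^sub>v u) \<le> m * vec_norm2 u"
    if tpq: "t \<le> l" "p \<le> \<eta>" "q \<le> \<epsilon>" and u: "u \<in> carrier_vec n" for t p q u
  proof -
    let ?B = "mat_block n (mat_poly_coeff M t) p q"
    have "?B \<in> {0\<^sub>m n n, 1\<^sub>m n} \<union> mat_poly_coeff P ` {0..d}" using M_blocks tpq by blast
    then consider "?B = 0\<^sub>m n n" | "?B = 1\<^sub>m n" | i where "i \<le> d" "?B = mat_poly_coeff P i" by auto
    then show ?thesis
    proof cases
      case 1
      then have "?B *\<^sub>v u = 0\<^sub>v n" using u by auto
      then show ?thesis using m1 by simp
    next
      case 2
      then show ?thesis using u m1 mult_right_mono[OF m1 vec_norm2_nonneg[of u]] by simp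
    next
      case 3
      have "vec_norm2 (?B *\<^sub>v u) \<le> f i * vec_norm2 u"
        unfolding 3(2) f_def by (rule vec_norm2_mult_le[OF mat_poly_coeff_carrier[OF P] u])
      also have "\<dots> \<le> m * vec_norm2 u"
        using f_le[OF 3(1)] by (intro mult_right_mono) (auto simp: m_def)
      finally show ?thesis .
    qed
  qed
  have Mt: "transpose_mat M \<in> carrier_mat ((\<epsilon> + 1) * n) ((\<eta> + 1) * n)" using M by simp
  have Mt_bound: "vec_norm2 (mat_block n (mat_poly_coeff (transpose_mat M) t) p q *\<^sub>v u) \<le> m * vec_norm2 u"
    if tpq: "t \<le> l" "p \<le> \<epsilon>" "q \<le> \<eta>" and u: "u \<in> carrier_vec n" for t p q u
  proof -
    have "mat_block n (mat_poly_coeff (transpose_mat M) t) p q = transpose_mat (mat_block n (mat_poly_coeff M t) q p)"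
      unfolding mat_poly_coeff_transpose
      using tpq by (intro mat_block_transpose[OF mat_poly_coeff_carrier[OF M]]) auto
    then show ?thesis
      using transpose_mult_bound[OF mat_block_carrier M_bound[OF tpq(1,3,2)] u] m1 by simp
  qed

  \<comment> \<open>Right and left null vectors of the pencil\<close>
  have L: "LL \<in> carrier_mat ((\<eta> + 1) * n + \<epsilon> * n) ((\<epsilon> + 1) * n + \<eta> * n)"
    unfolding LL by (rule kronecker_pencil_carrier[OF M])
  have v: "v \<in> carrier_vec ((\<epsilon> + 1) * n + \<eta> * n)"
    and Lv: "mat_poly_eval LL z *\<^sub>v v = 0\<^sub>v ((\<eta> + 1) * n + \<epsilon> * n)"
    using assms(12) carrier_matD[OF L] unfolding right_eigenvector_def by simp_all
  have w: "conjugate w \<in> carrier_vec ((\<eta> + 1) * n + \<epsilon> * n)"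
    and Lw: "mat_of_row (conjugate w) * mat_poly_eval LL z = 0\<^sub>m 1 ((\<epsilon> + 1) * n + \<eta> * n)"
    using assms(13) carrier_matD[OF L] unfolding left_eigenvector_def by simp_all
  have Lw': "transpose_mat (mat_poly_eval LL z) *\<^sub>v conjugate w = 0\<^sub>v ((\<epsilon> + 1) * n + \<eta> * n)"
    by (rule left_null_vector_transpose[OF mat_poly_eval_carrier[OF L] w Lw])
  have x: "x \<in> carrier_vec n" "x \<noteq> 0\<^sub>v n" "mat_poly_eval P z *\<^sub>v x = 0\<^sub>v n"
    using assms(10) P unfolding right_eigenvector_def by auto
  have y: "y \<in> carrier_vec n" "y \<noteq> 0\<^sub>v n" "mat_of_row (conjugate y) * mat_poly_eval P z = 0\<^sub>m 1 n"
    using assms(11) P unfolding left_eigenvector_def by auto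
  have cy: "conjugate y \<in> carrier_vec n" "conjugate y \<noteq> 0\<^sub>v n" using y by auto
  have Pt: "transpose_mat P \<in> carrier_mat n n" using P by simp
  have Py: "mat_poly_eval (transpose_mat P) z *\<^sub>v conjugate y = 0\<^sub>v n"
    unfolding mat_poly_eval_transpose
    by (rule left_null_vector_transpose[OF mat_poly_eval_carrier[OF P] cy(1) y(3)])
  have simple: "order z (Determinant.det P) = 1" "Determinant.det P \<noteq> 0"
    using assms(8) by (auto simp: simple_eigenvalue_def regular_mat_poly_def)
  note dett = det_transpose[OF P]
  obtain x' u where x': "x' \<in> carrier_vec n" and u: "u \<in> carrier_vec (\<eta> * n)"
    and v_eq: "v = Lambda_vec \<epsilon> s x' @\<^sub>v u" and Px': "mat_poly_eval P z *\<^sub>v x' = 0\<^sub>v n"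
    and v_norm: "vec_norm2 v \<le> real (\<eta> + 1) powr (3/2)
      * (real (l + 1) * m * real (\<epsilon> + 1) * \<rho> ^ (l * \<epsilon>) * vec_norm2 x')"
    using kronecker_pencil_kernel_bound[OF M grade P_eq P M_bound m1 \<rho>_def v Lv[unfolded LL]]
    unfolding s_def by blast
  have Pt_eq: "transpose_mat P = kronecker (transpose_mat (Lambda_mat \<epsilon> (monom 1 l))) (1\<^sub>m n) * transpose_mat M
      * kronecker (Lambda_mat \<eta> (monom 1 l)) (1\<^sub>m n)"
    unfolding P_eq by (rule transpose_kronecker_sandwich[OF M])
  have Lw'': "mat_poly_eval (kronecker_pencil \<eta> n \<epsilon> (monom 1 l) (transpose_mat M)) z *\<^sub>v conjugate w
      = 0\<^sub>v ((\<epsilon> + 1) * n + \<eta> * n)"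
    using Lw' unfolding LL transpose_kronecker_pencil[OF M, symmetric] mat_poly_eval_transpose .
  obtain y' t where y': "y' \<in> carrier_vec n" and t: "t \<in> carrier_vec (\<epsilon> * n)"
    and w_eq: "conjugate w = Lambda_vec \<eta> s y' @\<^sub>v t"
    and Py': "mat_poly_eval (transpose_mat P) z *\<^sub>v y' = 0\<^sub>v n"
    and w_norm: "vec_norm2 (conjugate w) \<le> real (\<epsilon> + 1) powr (3/2)
      * (real (l + 1) * m * real (\<eta> + 1) * \<rho> ^ (l * \<eta>) * vec_norm2 y')"
    using kronecker_pencil_kernel_bound[OF Mt mat_poly_has_grade_transpose[OF grade] Pt_eq Pt Mt_bound m1 \<rho>_def w Lw'']
    unfolding s_def by blast
  obtain a where a: "x' = a \<cdot>\<^sub>v x"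
    using simple_eigenvalue_kernel[OF P simple x x' Px'] by blast
  \<comment> \<open>The transpose of \<open>P\<close> has the same determinant, so \<open>z\<close>
    is a simple root for it as well.\<close>
  obtain b where b: "y' = b \<cdot>\<^sub>v conjugate y"
    using simple_eigenvalue_kernel[OF Pt _ _ cy Py y' Py'] simple dett by auto
  define D where "D = conjugate y \<bullet> (mat_poly_eval (mat_poly_deriv P) z *\<^sub>v x)"
  \<comment> \<open>The scalar \<open>b\<close> appears unconjugated because it relates
    \<open>y'\<close> to \<open>conjugate y\<close>. Both scalars cancel later against the norms of
    \<open>x'\<close> and \<open>y'\<close>.\<close>
  have deriv: "conjugate w \<bullet> (mat_poly_eval (mat_poly_deriv LL) z *\<^sub>v v) = b * (a * D)"
  proof -
    note P' = mat_poly_eval_carrier[OF mat_poly_deriv_carrier[OF P], of z]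
    have "conjugate w \<bullet> (mat_poly_eval (mat_poly_deriv LL) z *\<^sub>v v)
        = y' \<bullet> (mat_poly_eval (mat_poly_deriv P) z *\<^sub>v x')"
      unfolding LL v_eq w_eq
      by (rule kronecker_pencil_deriv(2)[OF M P_eq P x' y' u t s_def])
        (use Lv Lw' in \<open>simp_all only: LL v_eq w_eq\<close>)
    also have "\<dots> = b * (a * D)"
      unfolding a b D_def mult_mat_vec[OF P' x(1)]
      using cy y(1) x(1) P' mult_mat_vec_carrier[OF P' x(1)]
      by (subst scalar_prod_smult_left) (auto simp: scalar_prod_smult_right)
    finally show ?thesis .
  qed

  \<comment> \<open>The numerator for the pencil and the ratio estimate\<close>
  define SL where "SL = (\<Sum>i=0..l. cmod z ^ i * spectral_norm (mat_poly_coeff LL i))"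
  define S where "S = (\<Sum>i=0..d. cmod z ^ i * f i)"
  define T where "T = spectral_norm (coeff_block_row d P) * (\<Sum>i=0..d. cmod z ^ i)"
  define G where "G = real (\<epsilon> + 1) powr (3/2) * real (\<eta> + 1) powr (3/2)"
  have SL: "SL \<le> real (l + 1) * (\<rho> ^ l * (m * real N))"
  proof -
    have "SL \<le> (\<Sum>i=0..l. \<rho> ^ l * (m * real N))"
      unfolding SL_def
    proof (intro sum_mono mult_mono)
      fix i assume "i \<in> {0..l}"
      then have i: "i \<le> l" by simp
      have "cmod z ^ i \<le> \<rho> ^ i" by (intro power_mono) (auto simp: \<rho>_def)
      also have "\<dots> \<le> \<rho> ^ l" using i \<rho>1 by (rule power_increasing)
      finally show "cmod z ^ i \<le> \<rho> ^ l" .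
      show "spectral_norm (mat_poly_coeff LL i) \<le> m * real N"
        unfolding LL N_def by (rule kronecker_pencil_coeff_norm_le[OF M M_bound[OF i] m1])
    qed (use \<rho>1 in auto)
    then show ?thesis by simp
  qed
  have main: "SL * vec_norm2 v * vec_norm2 w
      \<le> (16 * real d ^ 3 * G * m ^ 3) * \<rho> ^ d * (cmod a * vec_norm2 x * (cmod b * vec_norm2 y))"
  proof -
    define X where "X = vec_norm2 x'"
    define Y where "Y = vec_norm2 y'"
    have XY: "0 \<le> X" "0 \<le> Y" by (auto simp: X_def Y_def)
    have "SL * vec_norm2 v * vec_norm2 w
      \<le> real (l + 1) * (\<rho> ^ l * (m * real N))
        * (real (\<eta> + 1) powr (3/2) * (real (l + 1) * m * real (\<epsilon> + 1) * \<rho> ^ (l * \<epsilon>) * X))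
        * (real (\<epsilon> + 1) powr (3/2) * (real (l + 1) * m * real (\<eta> + 1) * \<rho> ^ (l * \<eta>) * Y))"
      using SL v_norm w_norm m1 \<rho>1 XY unfolding X_def Y_def vec_norm2_conjugate
      by (intro mult_mono) auto
    \<comment> \<open>The coefficient sum and the two null vectors each contribute one
      \<open>l + 1\<close> and one \<open>m\<close>; the exponents of \<open>\<rho>\<close> are
      \<open>l\<close>, \<open>l * \<epsilon>\<close> and \<open>l * \<eta>\<close>, with sum
      \<open>d\<close>.\<close>
    also have "\<dots> = (real (l + 1) ^ 3 * real N * (real (\<epsilon> + 1) * real (\<eta> + 1)))
        * (G * m ^ 3 * (\<rho> ^ l * \<rho> ^ (l * \<epsilon>) * \<rho> ^ (l * \<eta>)) * (X * Y))"
      unfolding G_def power3_eq_cube by (simp only: mult_ac)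
    also have "\<rho> ^ l * \<rho> ^ (l * \<epsilon>) * \<rho> ^ (l * \<eta>) = \<rho> ^ d"
      unfolding d N_def by (simp add: power_add algebra_simps)
    also have "(real (l + 1) ^ 3 * real N * (real (\<epsilon> + 1) * real (\<eta> + 1))) * (G * m ^ 3 * \<rho> ^ d * (X * Y))
        \<le> 16 * real d ^ 3 * (G * m ^ 3 * \<rho> ^ d * (X * Y))"
      unfolding d N_def using m1 \<rho>1 XY
      by (intro mult_right_mono combined_constant_le assms) (auto simp: G_def)
    finally show ?thesis by (simp add: X_def Y_def a b mult_ac)
  qed
  define R where "R = max 1 (MAX i\<in>{0..d}. f i ^ 3)"
  have n_pos: "0 < vec_norm2 x" "0 < vec_norm2 y"
    using x y vec_norm2_eq_0_iff by (auto simp: less_le)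
  \<comment> \<open>Both claims are instances: \<open>Q\<close> is \<open>S\<close> with
    \<open>\<nu>\<close> the minimum of \<open>f 0\<close> and \<open>f d\<close>, or
    \<open>T\<close> with \<open>\<nu>\<close> equal to \<open>\<mu>\<close>.\<close>
  have ratio: "coeff_cond l LL z v w / (Q * vec_norm2 x * vec_norm2 y / (cmod z * cmod D))
      \<le> 16 * real d ^ 3 * real (\<epsilon> + 1) powr (3/2) * real (\<eta> + 1) powr (3/2) * (R / \<nu>)"
    if "\<rho> ^ d * \<nu> \<le> Q" "0 < \<nu>" for Q \<nu>
  proof -
    have "coeff_cond l LL z v w = SL * vec_norm2 v * vec_norm2 w / (cmod z * (cmod a * cmod b * cmod D))"
      unfolding coeff_cond_def deriv SL_def[symmetric] by (simp add: norm_mult mult_ac)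
    then have "coeff_cond l LL z v w / (Q * vec_norm2 x * vec_norm2 y / (cmod z * cmod D))
        \<le> (16 * real d ^ 3 * G * m ^ 3) / \<nu>"
      using main that n_pos m1 \<rho>1 assms(9)
      by (simp only:) (intro condition_ratio_le[where R = "\<rho> ^ d"], auto simp: G_def)
    also have "\<dots> \<le> (16 * real d ^ 3 * G * R) / \<nu>"
      using m3 that(2) by (intro divide_right_mono mult_left_mono) (auto simp: G_def R_def)
    finally show ?thesis by (simp add: G_def mult_ac)
  qed

  \<comment> \<open>Lower bounds for the numerators of \<open>P\<close> and conclusion\<close>
  have fd: "0 < f d"
    using assms(3) P unfolding mat_poly_has_degree_def f_def
    by (intro spectral_norm_pos[OF mat_poly_coeff_carrier[OF P]]) auto
  have S: "\<rho> ^ d * min (f 0) (f d) \<le> S"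
    unfolding S_def \<rho>_def by (intro sum_powers_ge_min) (auto simp: f_def)
  have T: "\<rho> ^ d * \<mu> \<le> T"
  proof -
    have "\<mu> \<le> spectral_norm (coeff_block_row d P)"
      unfolding \<mu>_def f_def by (auto intro!: spectral_norm_coeff_le_block_row[OF P])
    \<comment> \<open>With all weights equal to 1 the minimum in \<open>sum_powers_ge_min\<close> is
      1.\<close>
    moreover have "\<rho> ^ d \<le> (\<Sum>i=0..d. cmod z ^ i)"
      using sum_powers_ge_min[of "cmod z" "\<lambda>_. 1" d] by (simp add: \<rho>_def)
    ultimately have "\<mu> * \<rho> ^ d \<le> T"
      unfolding T_def using \<rho>1 by (intro mult_mono) auto
    then show ?thesis by (simp add: mult.commute)
  qed
  have cond_P: "coeff_cond d P z x y = S * vec_norm2 x * vec_norm2 y / (cmod z * cmod D)"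
    "norm_cond d P z x y = T * vec_norm2 x * vec_norm2 y / (cmod z * cmod D)"
    by (simp_all add: coeff_cond_def norm_cond_def S_def T_def f_def D_def)
  have f0: "0 < f 0" if "mat_poly_coeff P 0 \<noteq> 0\<^sub>m n n"
    unfolding f_def using that by (intro spectral_norm_pos[OF mat_poly_coeff_carrier[OF P]])
  show ?thesis
    \<comment> \<open>For a nonzero constant coefficient, \<open>f0\<close> and \<open>fd\<close>
      make the minimum positive; \<open>\<mu>\<close> is positive because it is at least
      \<open>f d\<close>.\<close>
    unfolding f_def[symmetric] R_def[symmetric] \<mu>_def[symmetric] cond_P
    using ratio[OF S] ratio[OF T] f0 fd f_le[of d] by auto
qed

end
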